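(* Let $(M,\varphi,\xi,\eta,g)$ be a para-Kenmotsu manifold of dimension $2n+1$ and let $\mu\in\mathbb{R}$ be a constant. Assume that the symmetric $(0,2)$-tensor field $\alpha:=L_{\xi}g+2S+2\mu\,\eta\otimes\eta$ is parallel with respect to the Levi-Civita connection $\nabla$ of $g$ (i.e. $\nabla\alpha=0$). Then $(g,\xi,\mu)$ yields an $\eta$-Ricci soliton, i.e. there is a real constant $\lambda$ such that $L_{\xi}g+2S+2\lambda g+2\mu\,\eta\otimes\eta=0$ on $M$.
   Context: An almost paracontact metric structure on a $(2n+1)$-dimensional smooth manifold $M$ is $(\varphi,\xi,\eta,g)$, where $\varphi$ is a $(1,1)$-tensor field, $\xi$ a vector field, $\eta$ a $1$-form and $g$ a pseudo-Riemannian metric of signature $(n+1,n)$, such that: (1) $\varphi\xi=0$, $\eta\circ\varphi=0$; (2) $\eta(\xi)=1$, $\varphi^2=I-\eta\otimes\xi$; (3) $\varphi$ induces on the $2n$-dimensional distribution $\mathcal{D}=\ker\eta$ an almost paracomplex structure $P$, i.e. $P^2=I$ on $\mathcal{D}$ and the eigensubbundles of $P$ for the eigenvalues $1$ and $-1$ both have rank $n$; (4) $g(\varphi X,\varphi Y)=-g(X,Y)+\eta(X)\eta(Y)$ for all vector fields $X,Y$. It follows that $\eta(X)=g(X,\xi)$. The structure is para-Kenmotsu (and $(M,\varphi,\xi,\eta,g)$ is a para-Kenmotsu manifold) if the Levi-Civita connection $\nabla$ of $g$ satisfies $(\nabla_X\varphi)Y=g(\varphi X,Y)\xi-\eta(Y)\varphi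 X$ for all vector fields $X,Y$. $R(X,Y)Z=\nabla_X\nabla_YZ-\nabla_Y\nabla_XZ-\nabla_{[X,Y]}Z$ is the Riemann curvature tensor, $S(Y,Z)=\operatorname{trace}(X\mapsto R(X,Y)Z)$ is the Ricci curvature tensor of $g$, and $L_\xi$ is the Lie derivative along $\xi$. *)

theory Defs
  imports "HOL-Analysis.Analysis"
begin

text \<open>Meant for open \<open>S\<close>: \<open>f\<close> is \<open>k\<close> times continuously differentiable on \<open>S\<close>.\<close>

primrec C_k_on :: "nat \<Rightarrow> ('a::euclidean_space \<Rightarrow> 'b::real_normed_vector) \<Rightarrow> 'a set \<Rightarrow> bool" where
  "C_k_on 0 f S \<longleftrightarrow> continuous_on S f"
| "C_k_on (Suc k) f S \<longleftrightarrow>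
     (\<forall>x\<in>S. f differentiable (at x)) \<and>
     (\<forall>v. C_k_on k (\<lambda>x. frechet_derivative f (at x) v) S)"

definition smooth_on :: "('a::euclidean_space \<Rightarrow> 'b::real_normed_vector) \<Rightarrow> 'a set \<Rightarrow> bool" where
  "smooth_on f S \<longleftrightarrow> (\<forall>k. C_k_on k f S)"

text \<open>A chart is a pair of its domain and its coordinate map. The underlying set of a manifold is
  the whole type \<open>'m\<close>, and the dimension is \<open>CARD('d)\<close>.\<close>

type_synonym ('m, 'd) chart = "'m set \<times> ('m \<Rightarrow> real^'d)"

definition chart_inv :: "('m, 'd::finite) chart \<Rightarrow> real^'d \<Rightarrow> 'm" where
  "chart_inv c = inv_into (fst c) (snd c)"

definition is_chart :: "('m::topological_space, 'd::finite) chart \<Rightarrow> bool" where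
  "is_chart c \<longleftrightarrow> open (fst c) \<and> open (snd c ` fst c) \<and>
     homeomorphism (fst c) (snd c ` fst c) (snd c) (chart_inv c)"

definition smooth_manifold ::
  "('m::{t2_space, second_countable_topology}, 'd::finite) chart set \<Rightarrow> bool" where
  "smooth_manifold A \<longleftrightarrow>
     (\<forall>c\<in>A. is_chart c) \<and> (\<Union>c\<in>A. fst c) = UNIV \<and>
     (\<forall>c\<in>A. \<forall>c'\<in>A. smooth_on (snd c' \<circ> chart_inv c) (snd c ` (fst c \<inter> fst c')))"

definition smooth_in_chart ::
  "('m, 'd::finite) chart \<Rightarrow> ('m \<Rightarrow> 'b::real_normed_vector) \<Rightarrow> bool" where
  "smooth_in_chart c F \<longleftrightarrow> smooth_on (F \<circ> chart_inv c) (snd c ` fst c)"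

definition smooth_function :: "('m, 'd::finite) chart set \<Rightarrow> ('m \<Rightarrow> real) \<Rightarrow> bool" where
  "smooth_function A f \<longleftrightarrow> (\<forall>c\<in>A. smooth_in_chart c f)"

text \<open>Every point \<open>p\<close> has a preferred chart \<open>chart_at A p\<close>, and a tangent vector at \<open>p\<close> is stored as
  its vector of components in that chart. So the tangent space at each point is \<open>real^'d\<close> as a
  vector space, but \<open>real^'d\<close> is not a global trivialisation of the tangent bundle: in any other
  chart components are obtained with the derivative of the coordinate change, and smoothness
  of fields always refers to those.\<close>

definition chart_at :: "('m, 'd::finite) chart set \<Rightarrow> 'm \<Rightarrow> ('m, 'd) chart" where
  "chart_at A p = (SOME c. c \<in> A \<and> p \<in> fst c)"

text \<open>Components in the chart \<open>c\<close> of the tangent vector \<open>v\<close> at \<open>p\<close>.\<close>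

definition components ::
  "('m, 'd::finite) chart set \<Rightarrow> ('m, 'd) chart \<Rightarrow> 'm \<Rightarrow> real^'d \<Rightarrow> real^'d" where
  "components A c p v =
     frechet_derivative (snd c \<circ> chart_inv (chart_at A p)) (at (snd (chart_at A p) p)) v"

text \<open>The tangent vector at \<open>p\<close> whose components in the chart \<open>c\<close> are \<open>w\<close>.\<close>

definition tangent_of ::
  "('m, 'd::finite) chart set \<Rightarrow> ('m, 'd) chart \<Rightarrow> 'm \<Rightarrow> real^'d \<Rightarrow> real^'d" where
  "tangent_of A c p w =
     frechet_derivative (snd (chart_at A p) \<circ> chart_inv c) (at (snd c p)) w"

type_synonym ('m, 'd) vfield = "'m \<Rightarrow> real^'d"
type_synonym ('m, 'd) covfield = "'m \<Rightarrow> real^'d \<Rightarrow> real"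
type_synonym ('m, 'd) endofield = "'m \<Rightarrow> real^'d \<Rightarrow> real^'d"
type_synonym ('m, 'd) bilfield = "'m \<Rightarrow> real^'d \<Rightarrow> real^'d \<Rightarrow> real"

definition vector_field :: "('m, 'd::finite) chart set \<Rightarrow> ('m, 'd) vfield \<Rightarrow> bool" where
  "vector_field A X \<longleftrightarrow> (\<forall>c\<in>A. smooth_in_chart c (\<lambda>p. components A c p (X p)))"

definition one_form :: "('m, 'd::finite) chart set \<Rightarrow> ('m, 'd) covfield \<Rightarrow> bool" where
  "one_form A \<eta> \<longleftrightarrow> (\<forall>p. linear (\<eta> p)) \<and>
     (\<forall>c\<in>A. \<forall>w. smooth_in_chart c (\<lambda>p. \<eta> p (tangent_of A c p w)))"

definition tensor_field_11 :: "('m, 'd::finite) chart set \<Rightarrow> ('m, 'd) endofield \<Rightarrow> bool" where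
  "tensor_field_11 A \<phi> \<longleftrightarrow> (\<forall>p. linear (\<phi> p)) \<and>
     (\<forall>c\<in>A. \<forall>w. smooth_in_chart c (\<lambda>p. components A c p (\<phi> p (tangent_of A c p w))))"

definition tensor_field_02 :: "('m, 'd::finite) chart set \<Rightarrow> ('m, 'd) bilfield \<Rightarrow> bool" where
  "tensor_field_02 A g \<longleftrightarrow> (\<forall>p. bilinear (g p)) \<and>
     (\<forall>c\<in>A. \<forall>v w. smooth_in_chart c (\<lambda>p. g p (tangent_of A c p v) (tangent_of A c p w)))"

text \<open>Signature \<open>(r, s)\<close>: there is an orthonormal basis with \<open>r\<close> vectors of square \<open>1\<close> and \<open>s\<close> of
  square \<open>-1\<close>. This includes nondegeneracy.\<close>

definition has_signature ::
  "('v::euclidean_space \<Rightarrow> 'v \<Rightarrow> real) \<Rightarrow> nat \<Rightarrow> nat \<Rightarrow> bool" where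
  "has_signature b r s \<longleftrightarrow>
     (\<exists>P N. P \<inter> N = {} \<and> independent (P \<union> N) \<and> span (P \<union> N) = UNIV \<and>
        card P = r \<and> card N = s \<and>
        (\<forall>u\<in>P \<union> N. \<forall>v\<in>P \<union> N. u \<noteq> v \<longrightarrow> b u v = 0) \<and>
        (\<forall>u\<in>P. b u u = 1) \<and> (\<forall>u\<in>N. b u u = -1))"

definition pseudo_riemannian_metric ::
  "('m, 'd::finite) chart set \<Rightarrow> nat \<Rightarrow> nat \<Rightarrow> ('m, 'd) bilfield \<Rightarrow> bool" where
  "pseudo_riemannian_metric A r s g \<longleftrightarrow>
     tensor_field_02 A g \<and> (\<forall>p u v. g p u v = g p v u) \<and> (\<forall>p. has_signature (g p) r s)"

text \<open>The function \<open>X(f)\<close>.\<close>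

definition deriv_along ::
  "('m, 'd::finite) chart set \<Rightarrow> ('m, 'd) vfield \<Rightarrow> ('m \<Rightarrow> real) \<Rightarrow> 'm \<Rightarrow> real" where
  "deriv_along A X f p =
     frechet_derivative (f \<circ> chart_inv (chart_at A p)) (at (snd (chart_at A p) p)) (X p)"

definition local_rep ::
  "('m, 'd::finite) chart set \<Rightarrow> ('m, 'd) chart \<Rightarrow> ('m, 'd) vfield \<Rightarrow> real^'d \<Rightarrow> real^'d" where
  "local_rep A c X = (\<lambda>p. components A c p (X p)) \<circ> chart_inv c"

text \<open>\<open>[X, Y]\<^sup>i = X\<^sup>j \<partial>\<^sub>j Y\<^sup>i - Y\<^sup>j \<partial>\<^sub>j X\<^sup>i\<close>, in the preferred chart at the point.\<close>

definition lie_bracket ::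
  "('m, 'd::finite) chart set \<Rightarrow> ('m, 'd) vfield \<Rightarrow> ('m, 'd) vfield \<Rightarrow> ('m, 'd) vfield" where
  "lie_bracket A X Y p =
     (let c = chart_at A p; x = snd c p in
        frechet_derivative (local_rep A c Y) (at x) (X p)
        - frechet_derivative (local_rep A c X) (at x) (Y p))"

definition lie_derivative_02 ::
  "('m, 'd::finite) chart set \<Rightarrow> ('m, 'd) vfield \<Rightarrow> ('m, 'd) bilfield
   \<Rightarrow> ('m, 'd) vfield \<Rightarrow> ('m, 'd) vfield \<Rightarrow> 'm \<Rightarrow> real" where
  "lie_derivative_02 A V g X Y p =
     deriv_along A V (\<lambda>q. g q (X q) (Y q)) p
     - g p (lie_bracket A V X p) (Y p) - g p (X p) (lie_bracket A V Y p)"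

type_synonym ('m, 'd) connection = "('m, 'd) vfield \<Rightarrow> ('m, 'd) vfield \<Rightarrow> ('m, 'd) vfield"

definition affine_connection ::
  "('m, 'd::finite) chart set \<Rightarrow> ('m, 'd) connection \<Rightarrow> bool" where
  "affine_connection A nabla \<longleftrightarrow>
     (\<forall>X Y. vector_field A X \<longrightarrow> vector_field A Y \<longrightarrow> vector_field A (nabla X Y)) \<and>
     (\<forall>X X' Y. vector_field A X \<longrightarrow> vector_field A X' \<longrightarrow> vector_field A Y \<longrightarrow>
        nabla (\<lambda>p. X p + X' p) Y = (\<lambda>p. nabla X Y p + nabla X' Y p)) \<and>
     (\<forall>f X Y. smooth_function A f \<longrightarrow> vector_field A X \<longrightarrow> vector_field A Y \<longrightarrow>
        nabla (\<lambda>p. f p *\<^sub>R X p) Y = (\<lambda>p. f p *\<^sub>R nabla X Y p)) \<and>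
     (\<forall>X Y Y'. vector_field A X \<longrightarrow> vector_field A Y \<longrightarrow> vector_field A Y' \<longrightarrow>
        nabla X (\<lambda>p. Y p + Y' p) = (\<lambda>p. nabla X Y p + nabla X Y' p)) \<and>
     (\<forall>f X Y. smooth_function A f \<longrightarrow> vector_field A X \<longrightarrow> vector_field A Y \<longrightarrow>
        nabla X (\<lambda>p. f p *\<^sub>R Y p) = (\<lambda>p. deriv_along A X f p *\<^sub>R Y p + f p *\<^sub>R nabla X Y p))"

definition levi_civita_connection ::
  "('m, 'd::finite) chart set \<Rightarrow> ('m, 'd) bilfield \<Rightarrow> ('m, 'd) connection \<Rightarrow> bool" where
  "levi_civita_connection A g nabla \<longleftrightarrow>
     affine_connection A nabla \<and>
     (\<forall>X Y. vector_field A X \<longrightarrow> vector_field A Y \<longrightarrow>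
        (\<forall>p. nabla X Y p - nabla Y X p = lie_bracket A X Y p)) \<and>
     (\<forall>X Y Z. vector_field A X \<longrightarrow> vector_field A Y \<longrightarrow> vector_field A Z \<longrightarrow>
        (\<forall>p. deriv_along A X (\<lambda>q. g q (Y q) (Z q)) p
              = g p (nabla X Y p) (Z p) + g p (Y p) (nabla X Z p)))"

definition curvature ::
  "('m, 'd::finite) chart set \<Rightarrow> ('m, 'd) connection
   \<Rightarrow> ('m, 'd) vfield \<Rightarrow> ('m, 'd) vfield \<Rightarrow> ('m, 'd) vfield \<Rightarrow> ('m, 'd) vfield" where
  "curvature A nabla X Y Z p =
     nabla X (nabla Y Z) p - nabla Y (nabla X Z) p - nabla (lie_bracket A X Y) Z p"

text \<open>The curvature is tensorial, so the trace below does not depend on the chosen extensions.\<close>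

definition extension ::
  "('m, 'd::finite) chart set \<Rightarrow> 'm \<Rightarrow> real^'d \<Rightarrow> ('m, 'd) vfield" where
  "extension A p v = (SOME V. vector_field A V \<and> V p = v)"

definition ricci ::
  "('m, 'd::finite) chart set \<Rightarrow> ('m, 'd) connection
   \<Rightarrow> ('m, 'd) vfield \<Rightarrow> ('m, 'd) vfield \<Rightarrow> 'm \<Rightarrow> real" where
  "ricci A nabla Y Z p = trace (matrix (\<lambda>v. curvature A nabla (extension A p v) Y Z p))"

text \<open>\<open>\<nabla>\<alpha> = 0\<close> for a \<open>(0,2)\<close>-tensor field \<open>\<alpha>\<close> given by its values on vector fields.\<close>

definition parallel_02 ::
  "('m, 'd::finite) chart set \<Rightarrow> ('m, 'd) connection
   \<Rightarrow> (('m, 'd) vfield \<Rightarrow> ('m, 'd) vfield \<Rightarrow> 'm \<Rightarrow> real) \<Rightarrow> bool" where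
  "parallel_02 A nabla \<alpha> \<longleftrightarrow>
     (\<forall>X Y Z. vector_field A X \<longrightarrow> vector_field A Y \<longrightarrow> vector_field A Z \<longrightarrow>
        (\<forall>p. deriv_along A X (\<alpha> Y Z) p - \<alpha> (nabla X Y) Z p - \<alpha> Y (nabla X Z) p = 0))"

definition almost_paracomplex ::
  "nat \<Rightarrow> 'v::euclidean_space set \<Rightarrow> ('v \<Rightarrow> 'v) \<Rightarrow> bool" where
  "almost_paracomplex n D P \<longleftrightarrow>
     (\<forall>v\<in>D. P v \<in> D \<and> P (P v) = v) \<and>
     dim {v \<in> D. P v = v} = n \<and> dim {v \<in> D. P v = - v} = n"

definition almost_paracontact_metric ::
  "nat \<Rightarrow> ('m::{t2_space, second_countable_topology}, 'd::finite) chart set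
   \<Rightarrow> ('m, 'd) endofield \<Rightarrow> ('m, 'd) vfield \<Rightarrow> ('m, 'd) covfield \<Rightarrow> ('m, 'd) bilfield \<Rightarrow> bool" where
  "almost_paracontact_metric n A \<phi> \<xi> \<eta> g \<longleftrightarrow>
     smooth_manifold A \<and> CARD('d) = 2 * n + 1 \<and>
     tensor_field_11 A \<phi> \<and> vector_field A \<xi> \<and> one_form A \<eta> \<and>
     pseudo_riemannian_metric A (n + 1) n g \<and>
     (\<forall>p. \<phi> p (\<xi> p) = 0) \<and> (\<forall>p v. \<eta> p (\<phi> p v) = 0) \<and>
     (\<forall>p. \<eta> p (\<xi> p) = 1) \<and> (\<forall>p v. \<phi> p (\<phi> p v) = v - \<eta> p v *\<^sub>R \<xi> p) \<and>
     (\<forall>p. almost_paracomplex n {v. \<eta> p v = 0} (\<phi> p)) \<and>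
     (\<forall>p u v. g p (\<phi> p u) (\<phi> p v) = - g p u v + \<eta> p u * \<eta> p v)"

definition para_kenmotsu ::
  "nat \<Rightarrow> ('m::{t2_space, second_countable_topology}, 'd::finite) chart set
   \<Rightarrow> ('m, 'd) endofield \<Rightarrow> ('m, 'd) vfield \<Rightarrow> ('m, 'd) covfield \<Rightarrow> ('m, 'd) bilfield
   \<Rightarrow> ('m, 'd) connection \<Rightarrow> bool" where
  "para_kenmotsu n A \<phi> \<xi> \<eta> g nabla \<longleftrightarrow>
     almost_paracontact_metric n A \<phi> \<xi> \<eta> g \<and> levi_civita_connection A g nabla \<and>
     (\<forall>X Y. vector_field A X \<longrightarrow> vector_field A Y \<longrightarrow>
        (\<forall>p. nabla X (\<lambda>q. \<phi> q (Y q)) p - \<phi> p (nabla X Y p)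
              = g p (\<phi> p (X p)) (Y p) *\<^sub>R \<xi> p - \<eta> p (Y p) *\<^sub>R \<phi> p (X p)))"

end

theory Submission
  imports Defs
begin

text \<open>The para-Kenmotsu identity with \<open>Y = \<xi>\<close> gives \<open>\<nabla>\<^sub>X \<xi> = X - \<eta>(X) \<xi>\<close>, hence
  \<open>R(X, Y) \<xi> = \<eta>(X) Y - \<eta>(Y) X\<close> and \<open>S(Y, \<xi>) = -2n \<eta>(Y)\<close>. So \<open>\<alpha>(Y, \<xi>) = k \<eta>(Y)\<close> with the
  constant \<open>k = 2\<mu> - 4n\<close>. Evaluating \<open>\<nabla>\<^sub>Z \<alpha> = 0\<close> on \<open>(Y, \<xi>)\<close> gives
  \<open>\<alpha>(Y, \<nabla>\<^sub>Z \<xi>) = k (\<nabla>\<^sub>Z \<eta>)(Y) = k (g(Y, Z) - \<eta>(Y) \<eta>(Z))\<close>, and replacing \<open>\<nabla>\<^sub>Z \<xi>\<close> by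
  \<open>Z - \<eta>(Z) \<xi>\<close> yields \<open>\<alpha> = k g\<close>, so \<open>\<lambda> = 2n - \<mu>\<close>. As \<open>k\<close> is explicit, \<open>M\<close> may be disconnected.
  Splitting \<open>Z\<close> inside \<open>S(Y, Z)\<close> needs the tensoriality of \<open>R(X, Y) Z\<close> in \<open>Z\<close>, that is,
  \<open>[X, Y] f = X (Y f) - Y (X f)\<close>, which rests on the symmetry of second derivatives.\<close>

section \<open>Smooth maps between Euclidean spaces\<close>

lemma frechet_derivative_cong_open:
  assumes "open S" "x \<in> S" "\<And>y. y \<in> S \<Longrightarrow> f y = g y"
  shows "frechet_derivative f (at x) = frechet_derivative g (at x)"
proof -
  have "(f has_derivative D) (at x) \<longleftrightarrow> (g has_derivative D) (at x)" for D
    using has_derivative_transform_within_open[OF _ assms(1,2)] assms(3) by metis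
  then show ?thesis
    by (simp add: frechet_derivative_def)
qed

lemma differentiable_cong_open:
  assumes "open S" "x \<in> S" "\<And>y. y \<in> S \<Longrightarrow> f y = g y" "f differentiable (at x)"
  shows "g differentiable (at x)"
  using assms unfolding differentiable_def
  by (meson has_derivative_transform_within_open)

text \<open>On an open set the derivative at a point depends only on nearby values, so agreement on
  \<open>S\<close> passes to the derivatives; hence \<open>f\<close> and \<open>g\<close> vary in
  the induction. Later proofs use it to replace a derivative by an explicit formula.\<close>

lemma C_k_on_cong:
  assumes "open S" "\<And>x. x \<in> S \<Longrightarrow> f x = g x" "C_k_on k f S"
  shows "C_k_on k g S"
  using assms(2,3)
proof (induction k arbitrary: f g)
  case 0
  then show ?case by (simp cong: continuous_on_cong)
next
  case (Suc k)
  have "frechet_derivative f (at x) v = frechet_derivative g (at x) v" if "x \<in> S" for x v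
    using frechet_derivative_cong_open[OF assms(1) that, of f g] Suc.prems(1) by simp
  then have "C_k_on k (\<lambda>x. frechet_derivative g (at x) v) S" for v
    by (rule Suc.IH[of "\<lambda>x. frechet_derivative f (at x) v"]) (use Suc.prems in auto)
  moreover have "g differentiable (at x)" if "x \<in> S" for x
    using differentiable_cong_open[OF assms(1) that, of f g] Suc.prems that by auto
  ultimately show ?case by simp
qed

lemma C_k_on_subset: "C_k_on k f S \<Longrightarrow> T \<subseteq> S \<Longrightarrow> C_k_on k f T"
  by (induction k arbitrary: f) (auto intro: continuous_on_subset)

lemma C_k_on_Suc_D: "C_k_on (Suc k) f S \<Longrightarrow> C_k_on k f S"
proof (induction k arbitrary: f)
  case 0
  then show ?case
    by (auto intro!: continuous_at_imp_continuous_on differentiable_imp_continuous_within)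
qed auto

text \<open>Continuity and derivatives at a point see only a neighbourhood. This lets a cut-off
  field be checked on two overlapping open pieces.\<close>

lemma C_k_on_local:
  assumes "\<And>x. x \<in> S \<Longrightarrow> \<exists>U. open U \<and> x \<in> U \<and> C_k_on k f U"
  shows "C_k_on k f S"
  using assms
proof (induction k arbitrary: f)
  case 0
  then show ?case
    by (auto intro!: continuous_at_imp_continuous_on simp: continuous_on_eq_continuous_at) 
      (metis continuous_on_eq_continuous_at)
next
  case (Suc k)
  have "f differentiable (at x)" if "x \<in> S" for x
    using Suc.prems[OF that] by auto
  moreover have "C_k_on k (\<lambda>x. frechet_derivative f (at x) v) S" for v
    by (rule Suc.IH) (use Suc.prems in fastforce)
  ultimately show ?case by simp
qed

lemma C_k_on_const: "C_k_on k (\<lambda>x. c) S"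
  by (induction k arbitrary: c) auto

lemma C_k_on_bounded_linear: "bounded_linear f \<Longrightarrow> C_k_on k f S"
proof (cases k)
  case 0
  then show "bounded_linear f \<Longrightarrow> ?thesis"
    by (auto intro: linear_continuous_on)
next
  case (Suc j)
  assume "bounded_linear f"
  then have "(f has_derivative f) (at x)" for x
    by (rule bounded_linear_imp_has_derivative)
  then show ?thesis
    using Suc frechet_derivative_at[OF \<open>(f has_derivative f) (at _)\<close>, symmetric]
    by (auto simp: differentiable_def C_k_on_const)
qed

lemma C_k_on_add:
  assumes "open S" "C_k_on k f S" "C_k_on k g S"
  shows "C_k_on k (\<lambda>x. f x + g x) S"
  using assms(2,3)
proof (induction k arbitrary: f g)
  case 0
  then show ?case by (auto intro: continuous_intros)
next
  case (Suc k)
  have *: "frechet_derivative f (at x) v + frechet_derivative g (at x) v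
      = frechet_derivative (\<lambda>x. f x + g x) (at x) v" if "x \<in> S" for x v
  proof -
    have "((\<lambda>x. f x + g x) has_derivative
        (\<lambda>v. frechet_derivative f (at x) v + frechet_derivative g (at x) v)) (at x)"
      using Suc.prems that by (intro has_derivative_add) (auto simp flip: frechet_derivative_works)
    from frechet_derivative_at[OF this] show ?thesis by metis
  qed
  have "C_k_on k (\<lambda>x. frechet_derivative (\<lambda>x. f x + g x) (at x) v) S" for v
    by (rule C_k_on_cong[OF assms(1) * Suc.IH]) (use Suc.prems in auto)
  with Suc.prems show ?case by (auto intro: differentiable_add)
qed

text \<open>By the Leibniz rule the derivative is a sum of two such products, and each factor,
  differentiated or not, is of class \<open>k\<close>, so the induction hypothesis applies to
  both.\<close>

lemma (in bounded_bilinear) C_k_on_prod: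
  assumes "open S" "C_k_on k f S" "C_k_on k g S"
  shows "C_k_on k (\<lambda>x. prod (f x) (g x)) S"
  using assms(2,3)
proof (induction k arbitrary: f g)
  case 0
  then show ?case by (auto intro: continuous_on)
next
  case (Suc k)
  have der: "((\<lambda>x. prod (f x) (g x)) has_derivative
      (\<lambda>v. prod (f x) (frechet_derivative g (at x) v) + prod (frechet_derivative f (at x) v) (g x))) (at x)"
    if "x \<in> S" for x
    using Suc.prems that by (intro FDERIV) (auto simp flip: frechet_derivative_works)
  have "C_k_on k (\<lambda>x. prod (f x) (frechet_derivative g (at x) v)
      + prod (frechet_derivative f (at x) v) (g x)) S" for v
    by (intro C_k_on_add assms Suc.IH) (use Suc.prems C_k_on_Suc_D in auto)
  then have "C_k_on k (\<lambda>x. frechet_derivative (\<lambda>x. prod (f x) (g x)) (at x) v) S" for v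
    by (rule C_k_on_cong[OF assms(1), rotated]) (simp add: frechet_derivative_at[OF der, symmetric])
  with der show ?case by (auto simp: differentiable_def)
qed

lemma C_k_on_sum:
  assumes "open S" "\<And>i. i \<in> I \<Longrightarrow> C_k_on k (f i) S"
  shows "C_k_on k (\<lambda>x. \<Sum>i\<in>I. f i x) S"
  using assms(2)
  by (induction I rule: infinite_finite_induct) (auto intro: C_k_on_const C_k_on_add[OF assms(1)])

text \<open>\<open>C_k_on\<close> speaks only of derivatives in fixed directions. This expansion
  reduces a direction that varies with the point to finitely many fixed ones.\<close>

lemma linear_Basis_expansion:
  fixes f :: "'a::euclidean_space \<Rightarrow> 'b::real_vector"
  assumes "linear f"
  shows "f v = (\<Sum>b\<in>Basis. (v \<bullet> b) *\<^sub>R f b)"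
proof -
  have "f v = f (\<Sum>b\<in>Basis. (v \<bullet> b) *\<^sub>R b)"
    by (simp add: euclidean_representation)
  then show ?thesis
    by (simp add: linear_sum[OF assms] linear_scale[OF assms])
qed

text \<open>In the chain rule \<open>f\<close> is differentiated at \<open>g x\<close> in a
  direction depending on \<open>x\<close>. Expanded over \<open>Basis\<close>, the derivative is a
  sum of products of coefficients of class \<open>k\<close> with composites of a derivative of
  \<open>f\<close> and \<open>g\<close>; so \<open>f\<close> varies in the induction and
  \<open>g\<close> stays fixed.\<close>

lemma C_k_on_compose:
  fixes f :: "'b::euclidean_space \<Rightarrow> 'c::real_normed_vector" and g :: "'a::euclidean_space \<Rightarrow> 'b"
  assumes "open S" "C_k_on k f T" "C_k_on k g S" "g ` S \<subseteq> T"
  shows "C_k_on k (f \<circ> g) S"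
  using assms(2,3)
proof (induction k arbitrary: f)
  case 0
  then show ?case
    using continuous_on_compose[of S g f] continuous_on_subset[OF _ assms(4), of f] by simp
next
  case (Suc k)
  let ?F = "\<lambda>b x. frechet_derivative f (at (g x)) b"
  have der: "((f \<circ> g) has_derivative (\<lambda>v. ?F (frechet_derivative g (at x) v) x)) (at x)" if "x \<in> S" for x
    using diff_chain_at[of g "frechet_derivative g (at x)" x f "frechet_derivative f (at (g x))"]
      Suc.prems that assms(4)
    by (auto simp: o_def simp flip: frechet_derivative_works)
  have "linear (frechet_derivative f (at (g x)))" if "x \<in> S" for x
    using Suc.prems that assms(4) by (intro linear_frechet_derivative) auto
  then have exp: "(\<Sum>b\<in>Basis. (frechet_derivative g (at x) v \<bullet> b) *\<^sub>R ?F b x)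
      = frechet_derivative (f \<circ> g) (at x) v" if "x \<in> S" for x v
    unfolding frechet_derivative_at[OF der[OF that], symmetric]
    using that by (intro linear_Basis_expansion[symmetric]) auto
  have "C_k_on k (\<lambda>x. \<Sum>b\<in>Basis. (frechet_derivative g (at x) v \<bullet> b) *\<^sub>R ?F b x) S" for v
  proof (intro C_k_on_sum assms bounded_bilinear.C_k_on_prod[OF bounded_bilinear_scaleR]
      bounded_bilinear.C_k_on_prod[OF bounded_bilinear_inner])
    fix b :: 'b
    show "C_k_on k (?F b) S"
      using Suc.IH[of "\<lambda>y. frechet_derivative f (at y) b"] Suc.prems C_k_on_Suc_D by (auto simp: o_def)
  qed (use Suc.prems C_k_on_const in auto)
  then have "C_k_on k (\<lambda>x. frechet_derivative (f \<circ> g) (at x) v) S" for v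
    by (rule C_k_on_cong[OF assms(1), rotated]) (rule exp)
  with der show ?case
    unfolding C_k_on.simps differentiable_def by blast
qed

section \<open>Closure properties of smooth maps\<close>

lemma smooth_on_cong: "open S \<Longrightarrow> (\<And>x. x \<in> S \<Longrightarrow> f x = g x) \<Longrightarrow> smooth_on f S \<Longrightarrow> smooth_on g S"
  by (auto simp: smooth_on_def intro: C_k_on_cong[of S f g])

lemma smooth_on_subset: "smooth_on f S \<Longrightarrow> T \<subseteq> S \<Longrightarrow> smooth_on f T"
  by (auto simp: smooth_on_def intro: C_k_on_subset[of _ f S])

lemma smooth_on_local:
  "(\<And>x. x \<in> S \<Longrightarrow> \<exists>U. open U \<and> x \<in> U \<and> smooth_on f U) \<Longrightarrow> smooth_on f S"
  unfolding smooth_on_def by (intro allI C_k_on_local) blast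

lemma smooth_on_const: "smooth_on (\<lambda>x. c) S"
  by (simp add: smooth_on_def C_k_on_const)

lemma smooth_on_bounded_linear: "bounded_linear f \<Longrightarrow> smooth_on f S"
  by (simp add: smooth_on_def C_k_on_bounded_linear)

lemma smooth_on_add:
  "open S \<Longrightarrow> smooth_on f S \<Longrightarrow> smooth_on g S \<Longrightarrow> smooth_on (\<lambda>x. f x + g x) S"
  by (simp add: smooth_on_def C_k_on_add)

lemma smooth_on_scaleR:
  "open S \<Longrightarrow> smooth_on f S \<Longrightarrow> smooth_on g S \<Longrightarrow> smooth_on (\<lambda>x. f x *\<^sub>R g x) S"
  by (simp add: smooth_on_def bounded_bilinear.C_k_on_prod[OF bounded_bilinear_scaleR])

lemma smooth_on_inner:
  "open S \<Longrightarrow> smooth_on f S \<Longrightarrow> smooth_on g S \<Longrightarrow> smooth_on (\<lambda>x. f x \<bullet> g x) S"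
  by (simp add: smooth_on_def bounded_bilinear.C_k_on_prod[OF bounded_bilinear_inner])

lemma smooth_on_sum:
  "open S \<Longrightarrow> (\<And>i. i \<in> I \<Longrightarrow> smooth_on (f i) S) \<Longrightarrow> smooth_on (\<lambda>x. \<Sum>i\<in>I. f i x) S"
  by (simp add: smooth_on_def C_k_on_sum)

lemma smooth_on_compose:
  "open S \<Longrightarrow> smooth_on f T \<Longrightarrow> smooth_on g S \<Longrightarrow> g ` S \<subseteq> T \<Longrightarrow> smooth_on (f \<circ> g) S"
  by (auto simp: smooth_on_def intro!: C_k_on_compose[where T=T] simp del: o_apply)

lemma smooth_on_differentiable: "smooth_on f S \<Longrightarrow> x \<in> S \<Longrightarrow> f differentiable (at x)"
  using C_k_on.simps(2)[of 0 f S] by (auto simp: smooth_on_def)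

lemma smooth_on_has_derivative:
  "smooth_on f S \<Longrightarrow> x \<in> S \<Longrightarrow> (f has_derivative frechet_derivative f (at x)) (at x)"
  using smooth_on_differentiable[of f S x] frechet_derivative_works[of f] by simp

lemma smooth_on_linear: "smooth_on f S \<Longrightarrow> x \<in> S \<Longrightarrow> linear (frechet_derivative f (at x))"
  by (rule linear_frechet_derivative[OF smooth_on_differentiable])

lemma smooth_on_frechet_derivative:
  "smooth_on f S \<Longrightarrow> smooth_on (\<lambda>x. frechet_derivative f (at x) v) S"
  using C_k_on.simps(2)[of _ f S] by (auto simp: smooth_on_def)

lemma smooth_on_continuous: "smooth_on f S \<Longrightarrow> continuous_on S f"
  using C_k_on.simps(1)[of f S] by (auto simp: smooth_on_def)

text \<open>Tensor fields are assumed smooth only on vectors with constant components; expanding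
  \<open>g x\<close> over \<open>Basis\<close> extends this to smoothly varying arguments.\<close>

lemma smooth_on_linear_family:
  fixes L :: "'a::euclidean_space \<Rightarrow> 'b::euclidean_space \<Rightarrow> 'c::real_normed_vector"
  assumes "open S" "\<And>x. x \<in> S \<Longrightarrow> linear (L x)" "\<And>b. smooth_on (\<lambda>x. L x b) S" "smooth_on g S"
  shows "smooth_on (\<lambda>x. L x (g x)) S"
proof (rule smooth_on_cong[OF assms(1)])
  show "smooth_on (\<lambda>x. \<Sum>b\<in>Basis. (g x \<bullet> b) *\<^sub>R L x b) S"
    by (intro smooth_on_sum smooth_on_scaleR smooth_on_inner smooth_on_const assms)
qed (rule linear_Basis_expansion[OF assms(2), symmetric])

section \<open>Symmetry of second derivatives\<close>

text \<open>Twofold application of the mean value theorem to the second difference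
  \<open>f (x + su + sv) - f (x + su) - f (x + sv) + f x\<close>.\<close>

lemma second_difference_mvt:
  fixes f :: "'a::euclidean_space \<Rightarrow> real"
  assumes f: "smooth_on f S" and s: "0 < s"
    and seg: "\<And>a b. 0 \<le> a \<Longrightarrow> a \<le> s \<Longrightarrow> 0 \<le> b \<Longrightarrow> b \<le> s \<Longrightarrow> x + a *\<^sub>R u + b *\<^sub>R v \<in> S"
  obtains a b where "0 < a" "a < s" "0 < b" "b < s"
    "f (x + s *\<^sub>R u + s *\<^sub>R v) - f (x + s *\<^sub>R u) - f (x + s *\<^sub>R v) + f x
      = s * s * frechet_derivative (\<lambda>y. frechet_derivative f (at y) u) (at (x + a *\<^sub>R u + b *\<^sub>R v)) v"
proof -
  let ?F = "\<lambda>y. frechet_derivative f (at y) u"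
  let ?p = "\<lambda>a. f (x + a *\<^sub>R u + s *\<^sub>R v) - f (x + a *\<^sub>R u)"
  have path: "((\<lambda>a. G (z + a *\<^sub>R w)) has_real_derivative frechet_derivative G (at (z + a *\<^sub>R w)) w) (at a)"
    if "smooth_on G S" "z + a *\<^sub>R w \<in> S" for G :: "'a \<Rightarrow> real" and z w a
  proof -
    have "((\<lambda>a. G (z + a *\<^sub>R w)) has_derivative (\<lambda>h. frechet_derivative G (at (z + a *\<^sub>R w)) (h *\<^sub>R w))) (at a)"
      by (rule has_derivative_compose[where f="\<lambda>a. z + a *\<^sub>R w" and g=G, OF _ smooth_on_has_derivative[OF that]])
        (auto intro!: derivative_eq_intros)
    then show ?thesis
      using linear_scale[OF smooth_on_linear[OF that]]
      by (simp add: has_field_derivative_def mult_commute_abs)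
  qed
  \<comment> \<open>First application, to \<open>?p\<close> as a function of \<open>a\<close>: its
    increment from 0 to \<open>s\<close> is the whole second difference. The second application
    keeps this \<open>a\<close> and varies \<open>b\<close>.\<close>
  have "(?p has_real_derivative ?F (x + a *\<^sub>R u + s *\<^sub>R v) - ?F (x + a *\<^sub>R u)) (at a)"
    if "0 \<le> a" "a \<le> s" for a
    using path[OF f, of "x + s *\<^sub>R v" a u] path[OF f, of x a u] seg[OF that, of s] seg[OF that, of 0] s
    by (auto intro!: DERIV_diff simp: algebra_simps)
  from MVT2[OF s this] obtain a where a: "0 < a" "a < s"
    "?p s - ?p 0 = (s - 0) * (?F (x + a *\<^sub>R u + s *\<^sub>R v) - ?F (x + a *\<^sub>R u))"
    by auto
  have "((\<lambda>b. ?F (x + a *\<^sub>R u + b *\<^sub>R v)) has_real_derivative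
      frechet_derivative ?F (at (x + a *\<^sub>R u + b *\<^sub>R v)) v) (at b)" if "0 \<le> b" "b \<le> s" for b
    by (rule path[OF smooth_on_frechet_derivative[OF f]]) (use seg a that in auto)
  from MVT2[OF s this] obtain b where b: "0 < b" "b < s"
    "?F (x + a *\<^sub>R u + s *\<^sub>R v) - ?F (x + a *\<^sub>R u + 0 *\<^sub>R v)
      = (s - 0) * frechet_derivative ?F (at (x + a *\<^sub>R u + b *\<^sub>R v)) v"
    by auto
  show ?thesis
    by (rule that[of a b]) (use a b in \<open>auto simp: algebra_simps\<close>)
qed

text \<open>The second difference does not change when u and v are exchanged, so the mean value form
  in both orders equates the two mixed derivatives at two points near \<open>x\<close>. Along
  sequences with coefficients below 1/(n+1) both points tend to \<open>x\<close>, and continuity of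
  the second derivatives gives equality there.\<close>

lemma second_derivative_symmetric:
  fixes f :: "'a::euclidean_space \<Rightarrow> real"
  assumes f: "smooth_on f S" and S: "open S" "x \<in> S"
  shows "frechet_derivative (\<lambda>y. frechet_derivative f (at y) u) (at x) v
       = frechet_derivative (\<lambda>y. frechet_derivative f (at y) v) (at x) u"
proof -
  let ?H = "\<lambda>u v y. frechet_derivative (\<lambda>y. frechet_derivative f (at y) u) (at y) v"
  have close: "\<exists>a b c d. \<bar>a\<bar> < e \<and> \<bar>b\<bar> < e \<and> \<bar>c\<bar> < e \<and> \<bar>d\<bar> < e \<and>
      ?H u v (x + a *\<^sub>R u + b *\<^sub>R v) = ?H v u (x + c *\<^sub>R v + d *\<^sub>R u)" if "0 < e" for e
  proof -
    obtain r where r: "r > 0" "ball x r \<subseteq> S"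
      using S openE by blast
    \<comment> \<open>Coefficients up to \<open>s\<close> move \<open>x\<close> by at most
      \<open>s * (norm u + norm v + 1)\<close>, which is at most r/2, so the parallelogram stays in
      \<open>S\<close>; the summand 1 keeps the denominator positive.\<close>
    define s where "s = min (e / 2) (r / (norm u + norm v + 1) / 2)"
    have den: "norm u + norm v + 1 > 0"
      by (smt (verit) norm_ge_zero)
    have s: "0 < s" "s < e" "s * (norm u + norm v + 1) < r"
    proof -
      show "0 < s" "s < e"
        using \<open>0 < e\<close> r den by (auto simp: s_def)
      have "s * (norm u + norm v + 1) \<le> (r / (norm u + norm v + 1) / 2) * (norm u + norm v + 1)"
        by (rule mult_right_mono) (use den in \<open>auto simp: s_def\<close>)
      also have "\<dots> = r / 2"
        using less_imp_neq[OF den] by (simp only: times_divide_eq_left nonzero_divide_eq_eq)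
      finally show "s * (norm u + norm v + 1) < r"
        using r by simp
    qed
    have bd: "norm (a *\<^sub>R u + b *\<^sub>R v) < r"
      if "0 \<le> a" "a \<le> s" "0 \<le> b" "b \<le> s" for a b
    proof -
      have "norm (a *\<^sub>R u + b *\<^sub>R v) \<le> a * norm u + b * norm v"
        using that norm_triangle_ineq[of "a *\<^sub>R u" "b *\<^sub>R v"] by simp
      also have "\<dots> \<le> s * norm u + s * norm v"
        using that by (intro add_mono mult_right_mono) auto
      also have "\<dots> \<le> s * (norm u + norm v + 1)"
        using s by (simp add: algebra_simps)
      finally show ?thesis using s by simp
    qed
    have uv: "x + a *\<^sub>R u + b *\<^sub>R v \<in> S" if "0 \<le> a" "a \<le> s" "0 \<le> b" "b \<le> s" for a b
    proof -
      have "dist (x + (a *\<^sub>R u + b *\<^sub>R v)) x < r"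
        using bd[OF that] by (simp only: dist_norm add_diff_cancel_left')
      then show ?thesis
        using r by (auto simp: add.assoc dist_commute)
    qed
    have vu: "x + b *\<^sub>R v + a *\<^sub>R u \<in> S" if "0 \<le> b" "b \<le> s" "0 \<le> a" "a \<le> s" for a b
      using uv[OF that(3,4,1,2)] by (simp add: algebra_simps)
    obtain a b where 1: "0 < a" "a < s" "0 < b" "b < s"
      "f (x + s *\<^sub>R u + s *\<^sub>R v) - f (x + s *\<^sub>R u) - f (x + s *\<^sub>R v) + f x
        = s * s * ?H u v (x + a *\<^sub>R u + b *\<^sub>R v)"
      using second_difference_mvt[OF f s(1) uv] by blast
    obtain c d where 2: "0 < c" "c < s" "0 < d" "d < s"
      "f (x + s *\<^sub>R v + s *\<^sub>R u) - f (x + s *\<^sub>R v) - f (x + s *\<^sub>R u) + f x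
        = s * s * ?H v u (x + c *\<^sub>R v + d *\<^sub>R u)"
      using second_difference_mvt[OF f s(1) vu] by blast
    have "s * s * ?H u v (x + a *\<^sub>R u + b *\<^sub>R v) = s * s * ?H v u (x + c *\<^sub>R v + d *\<^sub>R u)"
      unfolding 1(5)[symmetric] 2(5)[symmetric] by (simp add: algebra_simps)
    then have "?H u v (x + a *\<^sub>R u + b *\<^sub>R v) = ?H v u (x + c *\<^sub>R v + d *\<^sub>R u)"
      using s by simp
    with 1 2 s show ?thesis
      by (intro exI[of _ a] exI[of _ b] exI[of _ c] exI[of _ d]) auto
  qed
  have "\<forall>n. \<exists>a b c d. \<bar>a\<bar> < inverse (real (Suc n)) \<and> \<bar>b\<bar> < inverse (real (Suc n)) \<and>
      \<bar>c\<bar> < inverse (real (Suc n)) \<and> \<bar>d\<bar> < inverse (real (Suc n)) \<and>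
      ?H u v (x + a *\<^sub>R u + b *\<^sub>R v) = ?H v u (x + c *\<^sub>R v + d *\<^sub>R u)"
    using close by simp
  then obtain a b c d where abcd: "\<And>n. \<bar>a n\<bar> < inverse (real (Suc n))"
    "\<And>n. \<bar>b n\<bar> < inverse (real (Suc n))" "\<And>n. \<bar>c n\<bar> < inverse (real (Suc n))"
    "\<And>n. \<bar>d n\<bar> < inverse (real (Suc n))"
    "\<And>n. ?H u v (x + a n *\<^sub>R u + b n *\<^sub>R v) = ?H v u (x + c n *\<^sub>R v + d n *\<^sub>R u)"
    by metis
  have null: "q \<longlonglongrightarrow> 0" if "\<And>n. \<bar>q n\<bar> < inverse (real (Suc n))" for q :: "nat \<Rightarrow> real"
    by (rule Lim_null_comparison[OF _ LIMSEQ_inverse_real_of_nat])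
      (use that less_imp_le in \<open>auto intro!: always_eventually\<close>)
  have to_x: "(\<lambda>n. x + p n *\<^sub>R w + q n *\<^sub>R z) \<longlonglongrightarrow> x" if "p \<longlonglongrightarrow> 0" "q \<longlonglongrightarrow> 0"
    for p q :: "nat \<Rightarrow> real" and w z
    using tendsto_add[OF tendsto_add[OF tendsto_const tendsto_scaleR[OF that(1) tendsto_const]]
        tendsto_scaleR[OF that(2) tendsto_const], of x w z] by simp
  have cont: "isCont (?H w z) x" for w z
    using smooth_on_continuous[OF smooth_on_frechet_derivative[OF smooth_on_frechet_derivative[OF f]]]
      S continuous_on_eq_continuous_at by blast
  have "(\<lambda>n. ?H u v (x + a n *\<^sub>R u + b n *\<^sub>R v)) \<longlonglongrightarrow> ?H u v x"
    by (rule isCont_tendsto_compose[OF cont to_x]) (intro null abcd)+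
  moreover have "(\<lambda>n. ?H v u (x + c n *\<^sub>R v + d n *\<^sub>R u)) \<longlonglongrightarrow> ?H v u x"
    by (rule isCont_tendsto_compose[OF cont to_x]) (intro null abcd)+
  ultimately show ?thesis
    unfolding abcd(5) by (rule LIMSEQ_unique)
qed

section \<open>Smooth bump functions\<close>

text \<open>The one-sided functions \<open>t\<^sup>-\<^sup>m exp (-1/t)\<close>: their derivatives stay in the linear span of
  the family, so all of them are smooth.\<close>

definition flat_fun :: "nat \<Rightarrow> real \<Rightarrow> real" where
  "flat_fun m t = (if t \<le> 0 then 0 else (1 / t) ^ m * exp (- (1 / t)))"

text \<open>From the right, substituting 1/t gives a power divided by the exponential at infinity;
  from the left the function is 0.\<close>

lemma flat_fun_tendsto_0: "(flat_fun m \<longlongrightarrow> 0) (at 0)"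
proof -
  have "((\<lambda>t. (1 / t) ^ m / exp (1 / t)) \<longlongrightarrow> 0) (at_right (0::real))"
    by (rule filterlim_compose[OF tendsto_power_div_exp_0])
      (use filterlim_inverse_at_top_right in \<open>simp add: inverse_eq_divide\<close>)
  then have "(flat_fun m \<longlongrightarrow> 0) (at_right 0)"
    by (rule Lim_transform_eventually)
      (auto simp: eventually_at_filter flat_fun_def exp_minus field_simps)
  moreover have "(flat_fun m \<longlongrightarrow> 0) (at_left 0)"
    by (rule Lim_transform_eventually[OF tendsto_const])
      (auto simp: eventually_at_filter flat_fun_def)
  ultimately show ?thesis
    by (simp add: filterlim_split_at_real)
qed

lemma flat_fun_deriv:
  "(flat_fun m has_real_derivative flat_fun (m + 2) t - real m * flat_fun (m + 1) t) (at t)"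
proof -
  consider "t < 0" | "t = 0" | "t > 0" by linarith
  then show ?thesis
  proof cases
    case 1
    have "((\<lambda>t. 0) has_real_derivative 0) (at t)" by simp
    then have "(flat_fun m has_real_derivative 0) (at t)"
      by (rule has_field_derivative_transform_within_open[where S="{..<0}"])
        (use 1 in \<open>auto simp: flat_fun_def\<close>)
    with 1 show ?thesis by (simp add: flat_fun_def)
  next
    case 2
    \<comment> \<open>Dividing by h raises the exponent by one: away from 0 the difference quotient
      is \<open>flat_fun (Suc m) h\<close>.\<close>
    have "((\<lambda>h. (flat_fun m h - flat_fun m 0) / (h - 0)) \<longlongrightarrow> 0) (at 0)"
      by (rule Lim_transform_eventually[OF flat_fun_tendsto_0[of "Suc m"]])
        (auto simp: eventually_at_filter flat_fun_def)
    with 2 show ?thesis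
      by (simp add: has_field_derivative_iff) (simp add: flat_fun_def)
  next
    case 3
    have inv: "((\<lambda>t. 1 / t) has_real_derivative - ((1 / t) * (1 / t))) (at t)"
      using DERIV_inverse[of t] 3 by (simp add: inverse_eq_divide power2_eq_square)
    have "((\<lambda>t. (1 / t) ^ m * exp (- (1 / t))) has_real_derivative
        flat_fun (m + 2) t - real m * flat_fun (m + 1) t) (at t)"
      \<comment> \<open>The power rule carries the exponent m - 1, truncated at m = 0; hence the
        case split on \<open>m\<close>.\<close>
      by (rule DERIV_cong[OF DERIV_mult[OF DERIV_power[OF inv]
            DERIV_chain2[OF DERIV_exp DERIV_minus[OF inv]]]])
        (use 3 in \<open>cases m; simp add: flat_fun_def algebra_simps power_Suc del: power_one_over power_one_over\<close>)
    then show ?thesis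
      by (rule has_field_derivative_transform_within_open[where S="{0<..}"])
        (use 3 in \<open>auto simp: flat_fun_def\<close>)
  qed
qed

lemma flat_fun_C_k_on: "C_k_on k (flat_fun m) UNIV"
proof (induction k arbitrary: m)
  case 0
  then show ?case
    using DERIV_isCont[OF flat_fun_deriv] by (simp add: continuous_at_imp_continuous_on)
next
  case (Suc k)
  have D: "(flat_fun m has_derivative (\<lambda>v. v *\<^sub>R (flat_fun (m + 2) t + (- real m) *\<^sub>R flat_fun (m + 1) t))) (at t)" for t
    using flat_fun_deriv[of m t] by (simp add: has_field_derivative_def mult_commute_abs)
  have "C_k_on k (\<lambda>t. v *\<^sub>R (flat_fun (m + 2) t + (- real m) *\<^sub>R flat_fun (m + 1) t)) UNIV" for v :: real
    by (intro bounded_bilinear.C_k_on_prod[OF bounded_bilinear_scaleR] C_k_on_add C_k_on_const Suc open_UNIV)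
  with D show ?case
    by (auto simp: differentiable_def simp flip: frechet_derivative_at[OF D])
qed

lemma smooth_bump:
  fixes a :: "'a::euclidean_space"
  assumes "r > 0"
  obtains \<beta> :: "'a \<Rightarrow> real" where "smooth_on \<beta> UNIV" "\<beta> a = 1" "\<And>x. x \<notin> ball a r \<Longrightarrow> \<beta> x = 0"
proof
  \<comment> \<open>\<open>?h\<close> is positive exactly inside the ball and, being quadratic,
    smooth at the centre too. Dividing by the value at \<open>a\<close> normalises the bump.\<close>
  let ?h = "\<lambda>x. r\<^sup>2 + (-1) *\<^sub>R ((x - a) \<bullet> (x - a))"
  let ?\<beta> = "\<lambda>x. (1 / flat_fun 0 (r\<^sup>2)) *\<^sub>R (flat_fun 0 \<circ> ?h) x"
  have "smooth_on (\<lambda>x. x + (- a)) UNIV"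
    by (intro smooth_on_add smooth_on_bounded_linear smooth_on_const open_UNIV bounded_linear_ident)
  then have "smooth_on ?h UNIV"
    by (intro smooth_on_add smooth_on_const smooth_on_scaleR smooth_on_inner open_UNIV) auto
  then show "smooth_on ?\<beta> UNIV"
    using flat_fun_C_k_on
    by (intro smooth_on_scaleR smooth_on_const smooth_on_compose[where T=UNIV] open_UNIV) (auto simp: smooth_on_def)
  show "?\<beta> a = 1"
    using assms by (simp add: flat_fun_def)
  fix x assume "x \<notin> ball a r"
  then have "r \<le> norm (x - a)"
    by (simp add: dist_norm norm_minus_commute)
  then have "r\<^sup>2 \<le> (x - a) \<bullet> (x - a)"
    using assms power_mono[of r "norm (x - a)" 2] by (simp add: power2_norm_eq_inner)
  then show "?\<beta> x = 0"
    by (simp add: flat_fun_def)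
qed

text \<open>The product rule for evaluating a point-dependent linear map on a moving vector. With
  \<open>L\<close> the derivative of F and \<open>g\<close> a field W, it splits the derivative of
  W(F) into a first-order term and a second derivative with frozen argument.\<close>

lemma has_derivative_linear_family:
  fixes L :: "'a::euclidean_space \<Rightarrow> 'b::euclidean_space \<Rightarrow> 'c::real_normed_vector"
  assumes S: "open S" "x \<in> S" and lin: "\<And>x. x \<in> S \<Longrightarrow> linear (L x)"
    and sm: "\<And>b. smooth_on (\<lambda>x. L x b) S" and g: "smooth_on g S"
  shows "((\<lambda>y. L y (g y)) has_derivative
    (\<lambda>h. L x (frechet_derivative g (at x) h) + frechet_derivative (\<lambda>y. L y (g x)) (at x) h)) (at x)"
proof -
  let ?D = "\<lambda>b. frechet_derivative (\<lambda>y. L y b) (at x)"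
  have exp: "(\<Sum>b\<in>Basis. (w \<bullet> b) *\<^sub>R L y b) = L y w" if "y \<in> S" for y w
    by (rule linear_Basis_expansion[OF lin[OF that], symmetric])
  have D: "((\<lambda>y. L y b) has_derivative ?D b) (at x)" for b
    by (rule smooth_on_has_derivative[OF sm S(2)])
  have "((\<lambda>y. \<Sum>b\<in>Basis. (w \<bullet> b) *\<^sub>R L y b) has_derivative (\<lambda>h. \<Sum>b\<in>Basis. (w \<bullet> b) *\<^sub>R ?D b h)) (at x)" for w
    by (intro has_derivative_sum has_derivative_scaleR_right D)
  then have DW: "((\<lambda>y. L y w) has_derivative (\<lambda>h. \<Sum>b\<in>Basis. (w \<bullet> b) *\<^sub>R ?D b h)) (at x)" for w
    by (rule has_derivative_transform_within_open[OF _ S]) (rule exp)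
  have Dw: "(\<Sum>b\<in>Basis. (w \<bullet> b) *\<^sub>R ?D b h) = ?D w h" for w h
    by (rule frechet_derivative_at[OF DW, THEN fun_cong])
  have "((\<lambda>y. \<Sum>b\<in>Basis. (g y \<bullet> b) *\<^sub>R L y b) has_derivative
      (\<lambda>h. \<Sum>b\<in>Basis. (g x \<bullet> b) *\<^sub>R ?D b h + (frechet_derivative g (at x) h \<bullet> b) *\<^sub>R L x b)) (at x)"
    by (intro has_derivative_sum has_derivative_scaleR has_derivative_inner_left D
        smooth_on_has_derivative[OF g S(2)])
  then have "((\<lambda>y. L y (g y)) has_derivative
      (\<lambda>h. \<Sum>b\<in>Basis. (g x \<bullet> b) *\<^sub>R ?D b h + (frechet_derivative g (at x) h \<bullet> b) *\<^sub>R L x b)) (at x)"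
    by (rule has_derivative_transform_within_open[OF _ S]) (rule exp)
  then show ?thesis
    by (simp add: sum.distrib Dw exp[OF S(2)] add.commute)
qed

section \<open>Charts, vector fields and directional derivatives\<close>

context
  fixes A :: "('m::{t2_space, second_countable_topology}, 'd::finite) chart set"
  assumes manifold: "smooth_manifold A"
begin

section \<open>Charts and changes of coordinates\<close>

lemma chart_at: "chart_at A p \<in> A" "p \<in> fst (chart_at A p)"
proof -
  have "p \<in> (\<Union>c\<in>A. fst c)"
    using manifold by (simp add: smooth_manifold_def)
  then have "\<exists>c. c \<in> A \<and> p \<in> fst c"
    by blast
  from someI_ex[OF this] show "chart_at A p \<in> A" "p \<in> fst (chart_at A p)"
    by (auto simp: chart_at_def)
qed

lemma is_chart: "c \<in> A \<Longrightarrow> is_chart c"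
  using manifold by (simp add: smooth_manifold_def)

lemma chart_inv_left: "c \<in> A \<Longrightarrow> p \<in> fst c \<Longrightarrow> chart_inv c (snd c p) = p"
  using is_chart by (auto simp: is_chart_def homeomorphism_def)

lemma open_chart_domain: "c \<in> A \<Longrightarrow> open (fst c)"
  using is_chart by (auto simp: is_chart_def)

lemma continuous_on_chart_inv: "c \<in> A \<Longrightarrow> continuous_on (snd c ` fst c) (chart_inv c)"
  using is_chart by (auto simp: is_chart_def homeomorphism_def)

text \<open>This image is the preimage of \<open>U\<close> under the inverse chart, which is
  continuous on an open set.\<close>

lemma open_chart_image:
  assumes "c \<in> A" "open U"
  shows "open (snd c ` (fst c \<inter> U))"
proof -
  have "open (snd c ` fst c \<inter> chart_inv c -` U)"
    using is_chart[OF assms(1)] assms continuous_on_chart_inv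
    by (intro continuous_open_preimage) (auto simp: is_chart_def)
  moreover have "snd c ` (fst c \<inter> U) = snd c ` fst c \<inter> chart_inv c -` U"
    using chart_inv_left[OF assms(1)] by force
  ultimately show ?thesis by simp
qed

lemma open_chart_range: "c \<in> A \<Longrightarrow> open (snd c ` fst c)"
  using open_chart_image[of c UNIV] by simp

lemma smooth_coord_change:
  "c \<in> A \<Longrightarrow> c' \<in> A \<Longrightarrow> smooth_on (snd c' \<circ> chart_inv c) (snd c ` (fst c \<inter> fst c'))"
  using manifold by (simp add: smooth_manifold_def)

lemma coord_change_differentiable:
  "c \<in> A \<Longrightarrow> c' \<in> A \<Longrightarrow> p \<in> fst c \<Longrightarrow> p \<in> fst c' \<Longrightarrow>
    (snd c' \<circ> chart_inv c) differentiable (at (snd c p))"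
  by (rule smooth_on_differentiable[OF smooth_coord_change]) auto

text \<open>The chain rule for passing from \<open>c\<close> to \<open>c'\<close>; the factorisation
  of \<open>F\<close> holds only on the overlap of the domains, which is open. Taking
  \<open>F\<close> to be a coordinate map gives the transformation of tangent vectors, taking it to
  be a function gives the chart independence of X(f).\<close>

lemma frechet_derivative_change_chart:
  assumes c: "c \<in> A" "c' \<in> A" and p: "p \<in> fst c" "p \<in> fst c'"
    and F: "(F \<circ> chart_inv c') differentiable (at (snd c' p))"
  shows "frechet_derivative (F \<circ> chart_inv c) (at (snd c p)) w =
    frechet_derivative (F \<circ> chart_inv c') (at (snd c' p))
      (frechet_derivative (snd c' \<circ> chart_inv c) (at (snd c p)) w)"
proof -
  have "((F \<circ> chart_inv c') \<circ> (snd c' \<circ> chart_inv c) has_derivative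
     frechet_derivative (F \<circ> chart_inv c') (at (snd c' p))
      \<circ> frechet_derivative (snd c' \<circ> chart_inv c) (at (snd c p))) (at (snd c p))"
    using F coord_change_differentiable[OF c p] chart_inv_left[OF c(1) p(1)]
    by (intro diff_chain_at) (simp_all add: frechet_derivative_works)
  then have "(F \<circ> chart_inv c has_derivative
     frechet_derivative (F \<circ> chart_inv c') (at (snd c' p))
      \<circ> frechet_derivative (snd c' \<circ> chart_inv c) (at (snd c p))) (at (snd c p))"
    by (rule has_derivative_transform_within_open[OF _ open_chart_image[OF c(1) open_chart_domain[OF c(2)]]])
      (use p chart_inv_left[OF c(1)] chart_inv_left[OF c(2)] in auto)
  from frechet_derivative_at[OF this] show ?thesis
    by (metis comp_apply)
qed

lemma frechet_derivative_coord_change_self: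
  assumes "c \<in> A" "p \<in> fst c"
  shows "frechet_derivative (snd c \<circ> chart_inv c) (at (snd c p)) w = w"
proof -
  have "frechet_derivative (snd c \<circ> chart_inv c) (at (snd c p)) = frechet_derivative (\<lambda>x. x) (at (snd c p))"
    by (rule frechet_derivative_cong_open[OF open_chart_range[OF assms(1)]])
      (use assms chart_inv_left[OF assms(1)] in auto)
  then show ?thesis by simp
qed

lemma components_chart_at: "components A (chart_at A p) p v = v"
  by (simp add: components_def frechet_derivative_coord_change_self chart_at)

lemma tangent_of_chart_at: "tangent_of A (chart_at A p) p v = v"
  by (simp add: tangent_of_def frechet_derivative_coord_change_self chart_at)

lemma components_tangent_of:
  "c \<in> A \<Longrightarrow> c' \<in> A \<Longrightarrow> p \<in> fst c \<Longrightarrow> p \<in> fst c' \<Longrightarrow> components A c' p (tangent_of A c p w)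
    = frechet_derivative (snd c' \<circ> chart_inv c) (at (snd c p)) w"
  unfolding components_def tangent_of_def
  by (rule frechet_derivative_change_chart[symmetric]) (auto intro: coord_change_differentiable chart_at)

lemma tangent_of_components:
  assumes "c \<in> A" "p \<in> fst c"
  shows "tangent_of A c p (components A c p v) = v"
proof -
  have "v = frechet_derivative (snd (chart_at A p) \<circ> chart_inv (chart_at A p)) (at (snd (chart_at A p) p)) v"
    by (simp add: frechet_derivative_coord_change_self chart_at)
  also have "\<dots> = tangent_of A c p (components A c p v)"
    unfolding components_def tangent_of_def
    by (rule frechet_derivative_change_chart) (auto intro: coord_change_differentiable chart_at assms)
  finally show ?thesis by simp
qed

lemma linear_components: "c \<in> A \<Longrightarrow> p \<in> fst c \<Longrightarrow> linear (components A c p)"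
  using linear_frechet_derivative[OF coord_change_differentiable[of "chart_at A p" c p]] chart_at
  by (simp add: components_def[abs_def])

lemma linear_tangent_of: "c \<in> A \<Longrightarrow> p \<in> fst c \<Longrightarrow> linear (tangent_of A c p)"
  using linear_frechet_derivative[OF coord_change_differentiable[of c "chart_at A p" p]] chart_at
  by (simp add: tangent_of_def[abs_def])

section \<open>Smooth functions and vector fields\<close>

lemma smooth_in_chart_cong:
  assumes "c \<in> A" "\<And>p. p \<in> fst c \<Longrightarrow> F p = G p" "smooth_in_chart c F"
  shows "smooth_in_chart c G"
  using assms(3) unfolding smooth_in_chart_def
  by (rule smooth_on_cong[OF open_chart_range[OF assms(1)], rotated])
    (use assms(2) chart_inv_left[OF assms(1)] in auto)

lemma smooth_in_chart_add:
  "c \<in> A \<Longrightarrow> smooth_in_chart c F \<Longrightarrow> smooth_in_chart c G \<Longrightarrow> smooth_in_chart c (\<lambda>p. F p + G p)"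
  using smooth_on_add[OF open_chart_range] by (simp add: smooth_in_chart_def o_def)

lemma smooth_in_chart_scaleR:
  "c \<in> A \<Longrightarrow> smooth_in_chart c F \<Longrightarrow> smooth_in_chart c G \<Longrightarrow> smooth_in_chart c (\<lambda>p. F p *\<^sub>R G p)"
  using smooth_on_scaleR[OF open_chart_range] by (simp add: smooth_in_chart_def o_def)

lemma smooth_function_const: "smooth_function A (\<lambda>p. k)"
  by (simp add: smooth_function_def smooth_in_chart_def o_def smooth_on_const)

lemma vector_field_add:
  assumes "vector_field A X" "vector_field A Y"
  shows "vector_field A (\<lambda>p. X p + Y p)"
  unfolding vector_field_def
proof
  fix c assume "c \<in> A"
  then have "smooth_in_chart c (\<lambda>p. components A c p (X p) + components A c p (Y p))"
    using assms by (intro smooth_in_chart_add) (auto simp: vector_field_def)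
  then show "smooth_in_chart c (\<lambda>p. components A c p (X p + Y p))"
    by (rule smooth_in_chart_cong[OF \<open>c \<in> A\<close>, rotated])
      (simp add: linear_add[OF linear_components] \<open>c \<in> A\<close>)
qed

lemma vector_field_scaleR:
  assumes "smooth_function A f" "vector_field A X"
  shows "vector_field A (\<lambda>p. f p *\<^sub>R X p)"
  unfolding vector_field_def
proof
  fix c assume "c \<in> A"
  then have "smooth_in_chart c (\<lambda>p. f p *\<^sub>R components A c p (X p))"
    using assms by (intro smooth_in_chart_scaleR) (auto simp: vector_field_def smooth_function_def)
  then show "smooth_in_chart c (\<lambda>p. components A c p (f p *\<^sub>R X p))"
    by (rule smooth_in_chart_cong[OF \<open>c \<in> A\<close>, rotated])
      (simp add: linear_scale[OF linear_components] \<open>c \<in> A\<close>)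
qed

lemma vector_field_diff:
  assumes "vector_field A X" "vector_field A Y"
  shows "vector_field A (\<lambda>p. X p - Y p)"
  using vector_field_add[OF assms(1) vector_field_scaleR[OF smooth_function_const[of "-1"] assms(2)]]
  by simp

text \<open>In a chart, \<open>\<eta>\<close> becomes a family of linear forms smooth on fixed
  vectors, evaluated on the smooth components of \<open>X\<close>.\<close>

lemma smooth_function_one_form:
  assumes "one_form A \<eta>" "vector_field A X"
  shows "smooth_function A (\<lambda>p. \<eta> p (X p))"
  unfolding smooth_function_def smooth_in_chart_def
proof
  fix c assume c: "c \<in> A"
  note [simp] = chart_inv_left[OF c]
  let ?L = "\<lambda>y w. \<eta> (chart_inv c y) (tangent_of A c (chart_inv c y) w)"
  have "smooth_on (\<lambda>y. ?L y (components A c (chart_inv c y) (X (chart_inv c y)))) (snd c ` fst c)"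
  proof (rule smooth_on_linear_family[OF open_chart_range[OF c], where L="?L"])
    show "linear (?L y)" if "y \<in> snd c ` fst c" for y
      using assms(1) that linear_tangent_of[OF c, of "chart_inv c y"]
        linear_compose[of "tangent_of A c (chart_inv c y)" "\<eta> (chart_inv c y)"]
      by (auto simp: one_form_def o_def)
  qed (use assms c in \<open>auto simp: one_form_def vector_field_def smooth_in_chart_def o_def\<close>)
  then show "smooth_on ((\<lambda>p. \<eta> p (X p)) \<circ> chart_inv c) (snd c ` fst c)"
    by (rule smooth_on_cong[OF open_chart_range[OF c], rotated]) (auto simp: tangent_of_components c)
qed

section \<open>Directional derivatives and the Lie bracket\<close>

lemma smooth_function_differentiable:
  "smooth_function A f \<Longrightarrow> c \<in> A \<Longrightarrow> p \<in> fst c \<Longrightarrow> (f \<circ> chart_inv c) differentiable (at (snd c p))"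
  by (rule smooth_on_differentiable[of _ "snd c ` fst c"])
    (auto simp: smooth_function_def smooth_in_chart_def)

text \<open>The preferred chart can jump from point to point. Only in one chart fixed near a point
  can X(f) be shown smooth and be differentiated again.\<close>

lemma deriv_along_chart:
  assumes "smooth_function A f" "c \<in> A" "p \<in> fst c"
  shows "deriv_along A X f p =
    frechet_derivative (f \<circ> chart_inv c) (at (snd c p)) (components A c p (X p))"
  unfolding deriv_along_def components_def
  by (rule frechet_derivative_change_chart)
    (auto intro: smooth_function_differentiable assms chart_at)

lemma deriv_along_chart_inv:
  assumes "smooth_function A f" "c \<in> A" "y \<in> snd c ` fst c"
  shows "deriv_along A X f (chart_inv c y) =
    frechet_derivative (f \<circ> chart_inv c) (at y) (local_rep A c X y)"
  using deriv_along_chart[OF assms(1,2), of "chart_inv c y"] assms(3) chart_inv_left[OF assms(2)]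
  by (auto simp: local_rep_def)

lemma deriv_along_cmult:
  assumes "smooth_function A f"
  shows "deriv_along A X (\<lambda>q. k * f q) p = k * deriv_along A X f p"
proof -
  let ?c = "chart_at A p"
  have "((\<lambda>y. k * (f \<circ> chart_inv ?c) y) has_derivative
      (\<lambda>h. k * frechet_derivative (f \<circ> chart_inv ?c) (at (snd ?c p)) h)) (at (snd ?c p))"
    using smooth_function_differentiable[OF assms chart_at]
    by (intro has_derivative_mult_right) (simp only: frechet_derivative_works)
  from frechet_derivative_at[OF this, symmetric] show ?thesis
    by (simp add: deriv_along_def o_def)
qed

lemma deriv_along_const: "deriv_along A X (\<lambda>q. k) p = 0"
  by (simp add: deriv_along_def o_def)

lemma smooth_on_local_rep: "vector_field A X \<Longrightarrow> c \<in> A \<Longrightarrow> smooth_on (local_rep A c X) (snd c ` fst c)"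
  by (simp add: vector_field_def smooth_in_chart_def local_rep_def)

lemma smooth_on_chart_derivative:
  assumes "smooth_function A f" "c \<in> A"
  shows "smooth_on (\<lambda>y. frechet_derivative (f \<circ> chart_inv c) (at y) w) (snd c ` fst c)"
    "y \<in> snd c ` fst c \<Longrightarrow> linear (frechet_derivative (f \<circ> chart_inv c) (at y))"
  using assms by (auto simp: smooth_function_def smooth_in_chart_def
      intro!: smooth_on_frechet_derivative intro: smooth_on_linear)

lemma smooth_function_deriv_along:
  assumes "smooth_function A f" "vector_field A X"
  shows "smooth_function A (deriv_along A X f)"
  unfolding smooth_function_def smooth_in_chart_def
proof
  fix c assume c: "c \<in> A"
  have "smooth_on (\<lambda>y. frechet_derivative (f \<circ> chart_inv c) (at y) (local_rep A c X y)) (snd c ` fst c)"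
    using smooth_on_linear_family[where L="\<lambda>y. frechet_derivative (f \<circ> chart_inv c) (at y)",
        OF open_chart_range[OF c] smooth_on_chart_derivative(2,1)[OF assms(1) c] smooth_on_local_rep[OF assms(2) c]]
    by simp
  then show "smooth_on (deriv_along A X f \<circ> chart_inv c) (snd c ` fst c)"
    by (rule smooth_on_cong[OF open_chart_range[OF c], rotated])
      (simp add: deriv_along_chart_inv assms c)
qed

text \<open>In coordinates Z(W f) is dF applied to the derivative of W along Z, plus the second
  derivative of F in the directions W and Z. Antisymmetrising cancels the second part by symmetry
  and leaves dF of the bracket.\<close>

lemma deriv_along_lie_bracket:
  assumes f: "smooth_function A f" and X: "vector_field A X" and Y: "vector_field A Y"
  shows "deriv_along A (lie_bracket A X Y) f p =
    deriv_along A X (deriv_along A Y f) p - deriv_along A Y (deriv_along A X f) p"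
proof -
  define c where "c = chart_at A p"
  define F where "F = f \<circ> chart_inv c"
  have c: "c \<in> A" "p \<in> fst c"
    using chart_at c_def by auto
  have x: "snd c p \<in> snd c ` fst c"
    using c by auto
  \<comment> \<open>Since \<open>c\<close> is the preferred chart at \<open>p\<close>, the stored
    vector there is already its component vector in \<open>c\<close>.\<close>
  have rep: "local_rep A c Z (snd c p) = Z p" for Z
    using components_chart_at[of p] by (simp add: local_rep_def chart_inv_left c) (simp add: c_def)
  note S = open_chart_range[OF c(1)]
  have F: "smooth_on F (snd c ` fst c)"
    using f c by (simp add: F_def smooth_function_def smooth_in_chart_def)
  have iter: "deriv_along A Z (deriv_along A W f) p =
      frechet_derivative F (at (snd c p)) (frechet_derivative (local_rep A c W) (at (snd c p)) (Z p))
      + frechet_derivative (\<lambda>y. frechet_derivative F (at y) (W p)) (at (snd c p)) (Z p)"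
    if W: "vector_field A W" for Z W
  proof -
    have "deriv_along A Z (deriv_along A W f) p
        = frechet_derivative (deriv_along A W f \<circ> chart_inv c) (at (snd c p)) (Z p)"
      by (simp add: deriv_along_def c_def)
    also have "\<dots> = frechet_derivative (\<lambda>y. frechet_derivative F (at y) (local_rep A c W y)) (at (snd c p)) (Z p)"
      by (subst frechet_derivative_cong_open[OF S x]) (auto simp: deriv_along_chart_inv f c F_def)
    also have "\<dots> = frechet_derivative F (at (snd c p)) (frechet_derivative (local_rep A c W) (at (snd c p)) (Z p))
      + frechet_derivative (\<lambda>y. frechet_derivative F (at y) (local_rep A c W (snd c p))) (at (snd c p)) (Z p)"
      by (subst frechet_derivative_at[OF has_derivative_linear_family[where L="\<lambda>y. frechet_derivative F (at y)", OF S x _ _ smooth_on_local_rep[OF W c(1)]], symmetric])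
        (use smooth_on_frechet_derivative[OF F] smooth_on_linear[OF F] in auto)
    finally show ?thesis by (simp add: rep)
  qed
  have "deriv_along A (lie_bracket A X Y) f p = frechet_derivative F (at (snd c p))
      (frechet_derivative (local_rep A c Y) (at (snd c p)) (X p)
        - frechet_derivative (local_rep A c X) (at (snd c p)) (Y p))"
    by (simp add: deriv_along_def lie_bracket_def Let_def F_def c_def)
  then show ?thesis
    using second_derivative_symmetric[OF F S x, of "Y p" "X p"]
    by (simp add: iter X Y linear_diff[OF smooth_on_linear[OF F x]])
qed

section \<open>Extension of tangent vectors to global fields\<close>

text \<open>Without this, \<open>extension\<close> and hence \<open>ricci\<close> would be an arbitrary choice. The Hausdorff
  property makes the image of a closed coordinate ball closed, so that a field cut off inside the
  ball extends smoothly by \<open>0\<close>.\<close>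

lemma vector_field_extension_ex: "\<exists>V. vector_field A V \<and> V p = v"
proof -
  define c where "c = chart_at A p"
  have c: "c \<in> A" "p \<in> fst c"
    using chart_at c_def by auto
  obtain r where r: "r > 0" "cball (snd c p) r \<subseteq> snd c ` fst c"
    using open_chart_range[OF c(1)] c(2) open_contains_cball by blast
  obtain \<beta> :: "real^'d \<Rightarrow> real" where \<beta>: "smooth_on \<beta> UNIV" "\<beta> (snd c p) = 1"
    "\<And>x. x \<notin> ball (snd c p) r \<Longrightarrow> \<beta> x = 0"
    using smooth_bump[OF r(1)] by blast
  define K where "K = chart_inv c ` cball (snd c p) r"
  \<comment> \<open>The field with constant components \<open>v\<close> in the chart
    \<open>c\<close>, cut off by the bump.\<close>
  define V where "V = (\<lambda>q. if q \<in> fst c then \<beta> (snd c q) *\<^sub>R tangent_of A c q v else 0)"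
  have "closed K"
    unfolding K_def
    by (intro compact_imp_closed compact_continuous_image compact_cball
        continuous_on_subset[OF continuous_on_chart_inv r(2)] c)
  have "K \<subseteq> fst c"
    using r(2) chart_inv_left[OF c(1)] by (auto simp: K_def)
  have V0: "V q = 0" if "q \<notin> K" for q
  proof (cases "q \<in> fst c")
    case True
    then have "snd c q \<notin> ball (snd c p) r"
      using that chart_inv_left[OF c(1) True] ball_subset_cball[of "snd c p" r]
      unfolding K_def by (metis image_eqI subsetD)
    with True show ?thesis by (simp add: V_def \<beta>)
  qed (simp add: V_def)
  have "smooth_in_chart c' (\<lambda>q. components A c' q (V q))" if c': "c' \<in> A" for c'
    unfolding smooth_in_chart_def
  proof (rule smooth_on_local)
    fix y assume "y \<in> snd c' ` fst c'"
    then obtain q where q: "q \<in> fst c'" "y = snd c' q"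
      by auto
    show "\<exists>U. open U \<and> y \<in> U \<and> smooth_on ((\<lambda>q. components A c' q (V q)) \<circ> chart_inv c') U"
    \<comment> \<open>The domain of \<open>c\<close> and the complement of \<open>K\<close> are open
      and cover the manifold because \<open>K\<close> lies in that domain. On the first the
      transformation of components is a smooth coordinate formula, on the second \<open>V\<close>
      vanishes.\<close>
    proof (cases "q \<in> fst c")
      case True
      let ?N = "snd c' ` (fst c' \<inter> fst c)"
      let ?G = "\<lambda>z. \<beta> z *\<^sub>R frechet_derivative (snd c' \<circ> chart_inv c) (at z) v"
      have N: "open ?N"
        by (intro open_chart_image open_chart_domain c c')
      have "smooth_on ?G (snd c ` (fst c \<inter> fst c'))"
        by (intro smooth_on_scaleR smooth_on_subset[OF \<beta>(1)] smooth_on_frechet_derivative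
            smooth_coord_change open_chart_image open_chart_domain c c') auto
      then have "smooth_on (?G \<circ> (snd c \<circ> chart_inv c')) ?N"
        by (rule smooth_on_compose[OF N _ smooth_coord_change[OF c' c(1)]])
          (use chart_inv_left[OF c'] in auto)
      then have "smooth_on ((\<lambda>q. components A c' q (V q)) \<circ> chart_inv c') ?N"
        by (rule smooth_on_cong[OF N, rotated])
          (auto simp: chart_inv_left c c' V_def linear_scale[OF linear_components] components_tangent_of)
      with N True q show ?thesis by blast
    next
      case False
      let ?N = "snd c' ` (fst c' \<inter> - K)"
      have N: "open ?N"
        using \<open>closed K\<close> by (intro open_chart_image c') auto
      have "smooth_on ((\<lambda>q. components A c' q (V q)) \<circ> chart_inv c') ?N"
        by (rule smooth_on_cong[OF N _ smooth_on_const[of 0]])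
          (auto simp: chart_inv_left c' V0 linear_0[OF linear_components])
      with N False q \<open>K \<subseteq> fst c\<close> show ?thesis by blast
    qed
  qed
  then have "vector_field A V"
    by (simp add: vector_field_def)
  moreover have "V p = v"
    using c \<beta>(2) tangent_of_chart_at[of p] by (simp add: V_def) (simp add: c_def)
  ultimately show ?thesis by blast
qed

lemma extension: "vector_field A (extension A p v)" "extension A p v p = v"
  using someI_ex[OF vector_field_extension_ex[of p v]] by (auto simp: extension_def)

end

section \<open>Curvature of para-Kenmotsu manifolds\<close>

context
  fixes n :: nat
    and A :: "('m::{t2_space, second_countable_topology}, 'd::finite) chart set"
    and \<phi> :: "('m, 'd) endofield"
    and \<xi> :: "('m, 'd) vfield"
    and \<eta> :: "('m, 'd) covfield"
    and g :: "('m, 'd) bilfield"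
    and nabla :: "('m, 'd) connection"
  assumes para_kenmotsu: "para_kenmotsu n A \<phi> \<xi> \<eta> g nabla"
begin

section \<open>The structure tensors and the Levi-Civita connection\<close>

lemma almost_paracontact: "almost_paracontact_metric n A \<phi> \<xi> \<eta> g"
  using para_kenmotsu by (simp add: para_kenmotsu_def)

lemma manifold: "smooth_manifold A"
  using almost_paracontact by (simp add: almost_paracontact_metric_def)

lemma vector_field_xi: "vector_field A \<xi>"
  using almost_paracontact by (simp add: almost_paracontact_metric_def)

lemma one_form_eta: "one_form A \<eta>"
  using almost_paracontact by (simp add: almost_paracontact_metric_def)

lemma linear_eta: "linear (\<eta> p)"
  using one_form_eta by (simp add: one_form_def)

lemma bilinear_g: "bilinear (g p)"
  using almost_paracontact
  by (simp add: almost_paracontact_metric_def pseudo_riemannian_metric_def tensor_field_02_def)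

lemma g_sym: "g p u v = g p v u"
  using almost_paracontact
  by (simp add: almost_paracontact_metric_def pseudo_riemannian_metric_def)

lemma eta_xi: "\<eta> p (\<xi> p) = 1"
  using almost_paracontact by (simp add: almost_paracontact_metric_def)

text \<open>Inserting \<open>\<xi>\<close> in the compatibility of \<open>g\<close> with
  \<open>\<phi>\<close> makes the left side vanish, since \<open>\<phi>\<close> kills
  \<open>\<xi>\<close>.\<close>

lemma g_xi: "g p v (\<xi> p) = \<eta> p v"
proof -
  have "g p (\<phi> p v) (\<phi> p (\<xi> p)) = - g p v (\<xi> p) + \<eta> p v * \<eta> p (\<xi> p)"
    using almost_paracontact unfolding almost_paracontact_metric_def by blast
  moreover have "\<phi> p (\<xi> p) = 0"
    using almost_paracontact by (simp add: almost_paracontact_metric_def)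
  ultimately show ?thesis
    by (simp add: eta_xi bilinear_rzero[OF bilinear_g])
qed

lemma levi_civita: "levi_civita_connection A g nabla"
  using para_kenmotsu by (simp add: para_kenmotsu_def)

lemma
  assumes "vector_field A X" "vector_field A Y"
  shows vector_field_nabla: "vector_field A (nabla X Y)"
    and torsion_free: "lie_bracket A X Y p = nabla X Y p - nabla Y X p"
    and nabla_add_right: "vector_field A Y' \<Longrightarrow>
      nabla X (\<lambda>p. Y p + Y' p) = (\<lambda>p. nabla X Y p + nabla X Y' p)"
    and nabla_scaleR_right: "smooth_function A f \<Longrightarrow>
      nabla X (\<lambda>p. f p *\<^sub>R Y p) = (\<lambda>p. deriv_along A X f p *\<^sub>R Y p + f p *\<^sub>R nabla X Y p)"
    and metric_compatible: "vector_field A Z \<Longrightarrow>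
      deriv_along A X (\<lambda>q. g q (Y q) (Z q)) p = g p (nabla X Y p) (Z p) + g p (Y p) (nabla X Z p)"
  using levi_civita assms by (auto simp: levi_civita_connection_def affine_connection_def)

text \<open>Zero torsion writes the bracket as a difference of covariant derivatives, which are
  smooth; no coordinate computation is involved.\<close>

lemma vector_field_lie_bracket:
  assumes "vector_field A X" "vector_field A Y"
  shows "vector_field A (lie_bracket A X Y)"
proof -
  have "lie_bracket A X Y = (\<lambda>p. nabla X Y p - nabla Y X p)"
    using torsion_free[OF assms] by blast
  then show ?thesis
    by (simp add: vector_field_diff manifold vector_field_nabla assms)
qed

section \<open>Covariant derivatives and curvature along the Reeb field\<close>

lemma smooth_function_eta: "vector_field A X \<Longrightarrow> smooth_function A (\<lambda>p. \<eta> p (X p))"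
  by (rule smooth_function_one_form[OF manifold one_form_eta])

text \<open>Differentiating the constant \<open>g(\<xi>, \<xi>) = 1\<close> gives twice this
  quantity.\<close>

lemma eta_nabla_xi:
  assumes "vector_field A X"
  shows "\<eta> p (nabla X \<xi> p) = 0"
proof -
  have "deriv_along A X (\<lambda>q. g q (\<xi> q) (\<xi> q)) p = 0"
    by (simp add: g_xi eta_xi deriv_along_const[OF manifold])
  then show ?thesis
    using metric_compatible[OF assms vector_field_xi vector_field_xi, of p] g_sym[of p "\<xi> p"]
    by (simp add: g_xi)
qed

lemma nabla_xi:
  assumes X: "vector_field A X"
  shows "nabla X \<xi> = (\<lambda>p. X p - \<eta> p (X p) *\<^sub>R \<xi> p)"
proof
  fix p
  have phi: "\<phi> p (\<xi> p) = 0" "\<eta> p (\<phi> p v) = 0" "\<phi> p (\<phi> p v) = v - \<eta> p v *\<^sub>R \<xi> p" "linear (\<phi> p)" for p v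
    using almost_paracontact by (simp_all add: almost_paracontact_metric_def tensor_field_11_def)
  \<comment> \<open>The Leibniz rule with the zero function shows that the derivative of the zero
    field is zero, which is needed because \<open>\<phi>\<close> of \<open>\<xi>\<close> is the zero
    field.\<close>
  have "nabla X (\<lambda>q. 0 *\<^sub>R \<xi> q) = (\<lambda>p. deriv_along A X (\<lambda>q. 0) p *\<^sub>R \<xi> p + 0 *\<^sub>R nabla X \<xi> p)"
    by (rule nabla_scaleR_right[OF X vector_field_xi smooth_function_const[OF manifold]])
  then have 0: "nabla X (\<lambda>q. 0) = (\<lambda>p. 0)"
    by (simp add: deriv_along_const[OF manifold])
  have "nabla X (\<lambda>q. \<phi> q (\<xi> q)) p - \<phi> p (nabla X \<xi> p)
      = g p (\<phi> p (X p)) (\<xi> p) *\<^sub>R \<xi> p - \<eta> p (\<xi> p) *\<^sub>R \<phi> p (X p)"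
    using para_kenmotsu X vector_field_xi by (simp add: para_kenmotsu_def)
  then have "\<phi> p (nabla X \<xi> p) = \<phi> p (X p)"
    by (simp add: phi g_xi eta_xi 0)
  \<comment> \<open>A second \<open>\<phi>\<close> turns both sides into projections along
    \<open>\<xi>\<close>; the covariant derivative of \<open>\<xi>\<close> has no
    \<open>\<xi>\<close> component, so it is recovered entirely.\<close>
  then have "\<phi> p (\<phi> p (nabla X \<xi> p)) = \<phi> p (\<phi> p (X p))"
    by simp
  then show "nabla X \<xi> p = X p - \<eta> p (X p) *\<^sub>R \<xi> p"
    by (simp add: phi(3) eta_nabla_xi X)
qed

text \<open>As \<open>\<eta> = g(., \<xi>)\<close>, metric compatibility reduces this to
  \<open>nabla_xi\<close>. The terms beyond the first form the covariant derivative of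
  \<open>\<eta>\<close>, symmetric in X and Y.\<close>

lemma deriv_along_eta:
  assumes X: "vector_field A X" and Y: "vector_field A Y"
  shows "deriv_along A X (\<lambda>q. \<eta> q (Y q)) p
    = \<eta> p (nabla X Y p) + g p (X p) (Y p) - \<eta> p (X p) * \<eta> p (Y p)"
  using metric_compatible[OF X Y vector_field_xi, of p] g_sym[of p "Y p" "X p"]
  by (simp add: g_xi nabla_xi X bilinear_rsub[OF bilinear_g] bilinear_rmul[OF bilinear_g])

text \<open>With brackets written through the connection, the derivatives along \<open>\<xi>\<close>
  cancel by metric compatibility. What remains is
  \<open>g(\<nabla>\<^sub>Y \<xi>, Z) + g(Y, \<nabla>\<^sub>Z \<xi>)\<close>.\<close>

lemma lie_derivative_metric:
  assumes Y: "vector_field A Y" and Z: "vector_field A Z"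
  shows "lie_derivative_02 A \<xi> g Y Z p = 2 * (g p (Y p) (Z p) - \<eta> p (Y p) * \<eta> p (Z p))"
  using metric_compatible[OF vector_field_xi Y Z, of p] g_sym[of p "\<xi> p" "Z p"]
  by (simp add: lie_derivative_02_def torsion_free vector_field_xi Y Z nabla_xi g_xi
      bilinear_radd[OF bilinear_g] bilinear_rsub[OF bilinear_g] bilinear_rmul[OF bilinear_g]
      bilinear_ladd[OF bilinear_g] bilinear_lsub[OF bilinear_g] bilinear_lmul[OF bilinear_g]
      algebra_simps)

lemma nabla_nabla_xi:
  assumes X: "vector_field A X" and Y: "vector_field A Y"
  shows "nabla X (nabla Y \<xi>) p = nabla X Y p - deriv_along A X (\<lambda>q. \<eta> q (Y q)) p *\<^sub>R \<xi> p
    - \<eta> p (Y p) *\<^sub>R (X p - \<eta> p (X p) *\<^sub>R \<xi> p)"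
proof -
  \<comment> \<open>The sign goes into the coefficient so that the sum and Leibniz rules of the
    connection apply to \<open>Y + ?f \<xi>\<close>; smoothness of \<open>?f\<close> follows by
    viewing it as \<open>\<eta>\<close> of -Y.\<close>
  let ?f = "\<lambda>q. (-1) * \<eta> q (Y q)"
  have f: "smooth_function A ?f"
    using smooth_function_eta[OF vector_field_scaleR[OF manifold smooth_function_const[OF manifold, of "-1"] Y]]
    by (simp add: linear_neg[OF linear_eta])
  have "nabla X (\<lambda>q. Y q + ?f q *\<^sub>R \<xi> q) p
      = nabla X Y p + (deriv_along A X ?f p *\<^sub>R \<xi> p + ?f p *\<^sub>R nabla X \<xi> p)"
    by (simp only: nabla_add_right[OF X Y vector_field_scaleR[OF manifold f vector_field_xi]]
        nabla_scaleR_right[OF X vector_field_xi f])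
  then show ?thesis
    using deriv_along_cmult[OF manifold smooth_function_eta[OF Y], of X "-1" p]
    by (simp add: nabla_xi X Y)
qed

text \<open>The symmetry noted for the derivative of \<open>\<eta>\<close> gives
  \<open>X(\<eta>(Y)) - Y(\<eta>(X)) = \<eta>([X, Y])\<close>, so all bracket terms cancel and only
  the last terms of \<open>nabla_nabla_xi\<close> survive.\<close>

lemma curvature_xi:
  assumes X: "vector_field A X" and Y: "vector_field A Y"
  shows "curvature A nabla X Y \<xi> p = \<eta> p (X p) *\<^sub>R Y p - \<eta> p (Y p) *\<^sub>R X p"
  using g_sym[of p "X p" "Y p"]
  unfolding curvature_def nabla_nabla_xi[OF X Y] nabla_nabla_xi[OF Y X]
  by (simp add: nabla_xi vector_field_lie_bracket X Y torsion_free
      deriv_along_eta linear_diff[OF linear_eta] algebra_simps)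

section \<open>Tensoriality of the curvature in its last argument, and the Ricci tensor\<close>

lemma curvature_add:
  assumes X: "vector_field A X" and Y: "vector_field A Y" and Z: "vector_field A Z" and W: "vector_field A W"
  shows "curvature A nabla X Y (\<lambda>q. Z q + W q) p = curvature A nabla X Y Z p + curvature A nabla X Y W p"
  by (simp add: curvature_def nabla_add_right vector_field_nabla vector_field_lie_bracket X Y Z W)

text \<open>The terms with one derivative on \<open>f\<close> and one on \<open>Z\<close> are
  symmetric in X and Y and cancel. The second derivatives of \<open>f\<close> leave [X, Y] f, which
  the bracket term of the curvature removes.\<close>

lemma curvature_scaleR:
  assumes f: "smooth_function A f"
    and X: "vector_field A X" and Y: "vector_field A Y" and Z: "vector_field A Z"
  shows "curvature A nabla X Y (\<lambda>q. f q *\<^sub>R Z q) p = f p *\<^sub>R curvature A nabla X Y Z p"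
proof -
  have twice: "nabla X (nabla Y (\<lambda>q. f q *\<^sub>R Z q)) p
      = deriv_along A X (deriv_along A Y f) p *\<^sub>R Z p + deriv_along A Y f p *\<^sub>R nabla X Z p
        + deriv_along A X f p *\<^sub>R nabla Y Z p + f p *\<^sub>R nabla X (nabla Y Z) p"
    if X: "vector_field A X" and Y: "vector_field A Y" for X Y
    by (simp add: nabla_scaleR_right nabla_add_right vector_field_scaleR smooth_function_deriv_along
        vector_field_nabla manifold f X Y Z)
  show ?thesis
    unfolding curvature_def twice[OF X Y] twice[OF Y X]
    by (simp add: X Y nabla_scaleR_right vector_field_lie_bracket Z f
        deriv_along_lie_bracket[OF manifold f X Y] algebra_simps)
qed

lemma ricci_xi:
  assumes Y: "vector_field A Y"
  shows "ricci A nabla Y \<xi> p = - 2 * real n * \<eta> p (Y p)"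
proof -
  have card: "real CARD('d) = 2 * real n + 1"
    using almost_paracontact by (simp add: almost_paracontact_metric_def)
  \<comment> \<open>The trace of the rank-one map taking v to \<open>\<eta>(v) Y\<close>. The other
    part of the curvature is a multiple of the identity and contributes the dimension 2n +
    1.\<close>
  have eta: "(\<Sum>i\<in>UNIV. \<eta> p (axis i 1) * Y p $ i) = \<eta> p (Y p)"
  proof -
    have "\<eta> p (Y p) = \<eta> p (\<Sum>i\<in>UNIV. Y p $ i *\<^sub>R axis i 1)"
      using basis_expansion[of "Y p"] by (simp add: scalar_mult_eq_scaleR)
    then show ?thesis
      by (simp add: linear_sum[OF linear_eta] linear_scale[OF linear_eta] mult.commute)
  qed
  have "ricci A nabla Y \<xi> p = (\<Sum>i\<in>UNIV. (\<eta> p (axis i 1) *\<^sub>R Y p - \<eta> p (Y p) *\<^sub>R axis i 1) $ i)"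
    by (simp add: ricci_def trace_def matrix_def curvature_xi extension[OF manifold] Y)
  also have "\<dots> = \<eta> p (Y p) - real CARD('d) * \<eta> p (Y p)"
    by (simp add: sum_subtractf eta)
  finally show ?thesis
    by (simp add: card algebra_simps)
qed

lemma ricci_add:
  assumes "vector_field A Y" "vector_field A Z" "vector_field A W"
  shows "ricci A nabla Y (\<lambda>q. Z q + W q) p = ricci A nabla Y Z p + ricci A nabla Y W p"
  by (simp add: ricci_def trace_def matrix_def curvature_add extension[OF manifold] assms sum.distrib)

lemma ricci_scaleR:
  assumes "smooth_function A f" "vector_field A Y" "vector_field A Z"
  shows "ricci A nabla Y (\<lambda>q. f q *\<^sub>R Z q) p = f p * ricci A nabla Y Z p"
  by (simp add: ricci_def trace_def matrix_def curvature_scaleR extension[OF manifold] assms sum_distrib_left)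

text \<open>Decompose \<open>Z = \<nabla>\<^sub>Z \<xi> + \<eta>(Z) \<xi>\<close> as fields;
  linearity over functions in the last slot leaves only the known value on
  \<open>\<xi>\<close>.\<close>

lemma ricci_nabla_xi:
  assumes Y: "vector_field A Y" and Z: "vector_field A Z"
  shows "ricci A nabla Y (nabla Z \<xi>) p = ricci A nabla Y Z p + 2 * real n * (\<eta> p (Y p) * \<eta> p (Z p))"
proof -
  have f: "smooth_function A (\<lambda>q. \<eta> q (Z q))"
    by (rule smooth_function_eta[OF Z])
  have W: "vector_field A (nabla Z \<xi>)"
    by (rule vector_field_nabla[OF Z vector_field_xi])
  have "Z = (\<lambda>q. nabla Z \<xi> q + \<eta> q (Z q) *\<^sub>R \<xi> q)"
    by (simp add: nabla_xi Z)
  then have "ricci A nabla Y Z p = ricci A nabla Y (\<lambda>q. nabla Z \<xi> q + \<eta> q (Z q) *\<^sub>R \<xi> q) p"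
    by metis
  also have "\<dots> = ricci A nabla Y (nabla Z \<xi>) p + \<eta> p (Z p) * ricci A nabla Y \<xi> p"
    by (simp only: ricci_add[OF Y W vector_field_scaleR[OF manifold f vector_field_xi]]
        ricci_scaleR[OF f Y vector_field_xi])
  finally show ?thesis
    by (simp add: ricci_xi[OF Y])
qed

end

section \<open>A parallel tensor with known values on the Reeb field\<close>

theorem theorem3p2:
  fixes n :: nat
    and A :: "('m::{t2_space, second_countable_topology}, 'd::finite) chart set"
    and \<phi> :: "('m, 'd) endofield"
    and \<xi> :: "('m, 'd) vfield"
    and \<eta> :: "('m, 'd) covfield"
    and g :: "('m, 'd) bilfield"
    and nabla :: "('m, 'd) connection"
    and \<mu> :: real
  assumes "para_kenmotsu n A \<phi> \<xi> \<eta> g nabla"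
    and "parallel_02 A nabla
           (\<lambda>Y Z p. lie_derivative_02 A \<xi> g Y Z p + 2 * ricci A nabla Y Z p
                    + 2 * \<mu> * (\<eta> p (Y p) * \<eta> p (Z p)))"
  shows "\<exists>l::real. \<forall>Y Z. vector_field A Y \<longrightarrow> vector_field A Z \<longrightarrow>
           (\<forall>p. lie_derivative_02 A \<xi> g Y Z p + 2 * ricci A nabla Y Z p
                 + 2 * l * g p (Y p) (Z p) + 2 * \<mu> * (\<eta> p (Y p) * \<eta> p (Z p)) = 0)"
proof (intro exI[of _ "2 * real n - \<mu>"] allI impI)
  fix Y Z p
  assume Y: "vector_field A Y" and Z: "vector_field A Z"
  note pk = assms(1)
  note xi = vector_field_xi[OF pk]
  let ?\<alpha> = "\<lambda>Y Z p. lie_derivative_02 A \<xi> g Y Z p + 2 * ricci A nabla Y Z p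
                    + 2 * \<mu> * (\<eta> p (Y p) * \<eta> p (Z p))"
  define k where "k = 2 * \<mu> - 4 * real n"
  \<comment> \<open>The Lie derivative part vanishes on \<open>(V, \<xi>)\<close>; the Ricci part
    gives -4n and the last term 2 \<open>\<mu>\<close>.\<close>
  have \<alpha>_xi: "?\<alpha> V \<xi> q = k * \<eta> q (V q)" if V: "vector_field A V" for V q
    by (simp add: lie_derivative_metric[OF pk V xi] ricci_xi[OF pk V] g_xi[OF pk] eta_xi[OF pk]
        k_def algebra_simps)
  have W: "vector_field A (nabla Z \<xi>)"
    by (rule vector_field_nabla[OF pk Z xi])
  have "deriv_along A Z (?\<alpha> Y \<xi>) p - ?\<alpha> (nabla Z Y) \<xi> p - ?\<alpha> Y (nabla Z \<xi>) p = 0"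
    using assms(2) Y Z xi unfolding parallel_02_def by blast
  then have "k * deriv_along A Z (\<lambda>q. \<eta> q (Y q)) p - k * \<eta> p (nabla Z Y p) - ?\<alpha> Y (nabla Z \<xi>) p = 0"
    by (simp only: \<alpha>_xi[OF Y] \<alpha>_xi[OF vector_field_nabla[OF pk Z Y]]
        deriv_along_cmult[OF manifold[OF pk] smooth_function_eta[OF pk Y]])
  then have "?\<alpha> Y (nabla Z \<xi>) p = k * (g p (Y p) (Z p) - \<eta> p (Y p) * \<eta> p (Z p))"
    using g_sym[OF pk, of p "Y p" "Z p"]
    by (simp add: deriv_along_eta[OF pk Z Y] algebra_simps)
  \<comment> \<open>The same value computed directly: the \<open>\<mu>\<close> term drops out
    because \<open>\<eta>\<close> vanishes on \<open>\<nabla>\<^sub>Z \<xi>\<close>.\<close>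
  moreover have "?\<alpha> Y (nabla Z \<xi>) p
      = 2 * (g p (Y p) (Z p) - \<eta> p (Y p) * \<eta> p (Z p)) + 2 * ricci A nabla Y Z p
        + 4 * real n * (\<eta> p (Y p) * \<eta> p (Z p))"
    using eta_nabla_xi[OF pk Z, of p]
    by (simp add: lie_derivative_metric[OF pk Y W] ricci_nabla_xi[OF pk Y Z])
      (simp add: nabla_xi[OF pk Z] bilinear_rsub[OF bilinear_g[OF pk]]
        bilinear_rmul[OF bilinear_g[OF pk]] g_xi[OF pk] algebra_simps)
  \<comment> \<open>Equating both values, the coefficient of \<open>\<eta>(Y) \<eta>(Z)\<close>
    becomes -(k + 4n), that is -2 \<open>\<mu>\<close>, and that of g(Y, Z) becomes k, which is -2
    times the witness.\<close>
  ultimately show "lie_derivative_02 A \<xi> g Y Z p + 2 * ricci A nabla Y Z p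
      + 2 * (2 * real n - \<mu>) * g p (Y p) (Z p) + 2 * \<mu> * (\<eta> p (Y p) * \<eta> p (Z p)) = 0"
    by (simp add: lie_derivative_metric[OF pk Y Z] k_def algebra_simps)
qed

end
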